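(* Let $m,n$ be positive integers, $K=J(2m,-2n)$, $\xi=e^{2\pi\sqrt{-1}/(4mn+1)}$, and for $1\le i\le 2mn$ let $\rho_i\colon\pi_1(E_K)\to\mathrm{SL}_2(\mathbb{C})$ be the irreducible metabelian representation given by \[ \rho_i(x_1)=\begin{bmatrix}\xi^i&0\\0&\xi^{-i}\end{bmatrix},\quad \rho_i(x_2)=\begin{bmatrix}\xi^{2mi}&0\\0&\xi^{-2mi}\end{bmatrix},\quad \rho_i(\mu)=\begin{bmatrix}0&1\\-1&0\end{bmatrix}. \] Let $q_i=\frac{4mn+1}{\gcd(4mn+1,i)}$ and $(\rho_i)_{2N}=\sigma_{2N}\circ\rho_i$. Then \[ \lim_{N\to\infty}\frac{\log|\mathbb{T}_{K,(\rho_i)_{2N}}|}{2N}=\frac{1}{q_i}\log\frac{2mn+1}{2}+\frac12\log2=\frac{\gcd(4mn+1,i)}{4mn+1}\log\frac{2mn+1}{2}+\frac12\log2 . \] In particular, the growth order of $\log|\mathbb{T}_{K,(\rho_i)_{2N}}|$ is the same as $2N$ (in the sense that its quotient by $2N$ converges to a finite limit).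
   Context: $J(2m,-2n)$ is the double twist knot (a genus one two-bridge knot) in Hoste--Shanahan's notation. Its exterior $E_K=S^3\setminus N(K)$ has fundamental group with the Lin presentation (associated with a genus one free Seifert surface) \[ \pi_1(E_K)=\langle x_1,x_2,\mu\mid \mu x_1^m\mu^{-1}=x_1^mx_2^{-1},\ \mu x_2^{n}x_1\mu^{-1}=x_2^{n}\rangle, \] where $\mu$ is a meridian. The $\rho_i$, $1\le i\le 2mn$, represent all irreducible metabelian $\mathrm{SL}_2(\mathbb{C})$-representations of $\pi_1(E_K)$ up to conjugation (metabelian: the commutator subgroup has abelian image). $\sigma_n\colon\mathrm{SL}_2(\mathbb{C})\to\mathrm{SL}_n(\mathbb{C})$ is the $n$-dimensional irreducible representation, given by the action on the space of homogeneous polynomials $p(x,y)$ of degree $n-1$: $A\cdot p(x,y)=p(x',y')$ with $\binom{x'}{y'}=A^{-1}\binom{x}{y}$. Reidemeister torsion: for $\varphi\colon\pi_1(E_K)\to\mathrm{SL}_d(\mathbb{C})$ with linear extension $\widetilde\varphi$ to $\mathbb{Z}[\pi_1(E_K)]$, and $r_1=\mu x_1^m\mu^{-1}x_2x_1^{-m}$, $r_2=\mu x_2^{n}x_1\mu^{-1}x_2^{-n}$, the torsion is, up to sign, \[ \mathbb{T}_{K,\varphi}=\frac{\det\big(\widetilde\varphi(\partial r_k/\partial x_l)\big)_{1\le k,l\le2}}{\det\widetilde\varphi(\mu-1)}, \] defined when numerator and denominator are both nonzero (acyclicity of the twisted chain complex); $\partial r_k/\partial x_l$ are Fox derivatives.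 *)

theory Defs
  imports
    Complex_Main
    "HOL-Library.Poly_Mapping"
    "HOL-Algebra.Coset"
    "HOL-Algebra.Generated_Groups"
    "Jordan_Normal_Form.Determinant"
begin

section \<open>Free groups and group presentations\<close>

datatype 'g letter = Pos 'g | Neg 'g

type_synonym 'g word = "'g letter list"

fun inv_letter :: "'g letter \<Rightarrow> 'g letter" where
  "inv_letter (Pos g) = Neg g"
| "inv_letter (Neg g) = Pos g"

inductive free_step :: "'g word \<Rightarrow> 'g word \<Rightarrow> bool" where
  "free_step (u @ [l, inv_letter l] @ v) (u @ v)"

definition free_rel :: "('g word \<times> 'g word) set" where
  "free_rel = {(u, v). equivclp free_step u v}"

definition word_class :: "'g word \<Rightarrow> 'g word set" where
  "word_class w = free_rel `` {w}"

definition free_group :: "'g word set monoid" where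
  "free_group =
    \<lparr>carrier = UNIV // free_rel,
     monoid.mult = (\<lambda>A B. \<Union>a\<in>A. \<Union>b\<in>B. word_class (a @ b)),
     one = word_class []\<rparr>"

definition normal_closure :: "('a, 'b) monoid_scheme \<Rightarrow> 'a set \<Rightarrow> 'a set" where
  "normal_closure G S = \<Inter>{N. N \<lhd> G \<and> S \<subseteq> N}"

definition relator_closure :: "'g word set \<Rightarrow> 'g word set set" where
  "relator_closure R = normal_closure free_group (word_class ` R)"

definition presented_group :: "'g word set \<Rightarrow> 'g word set set monoid" where
  "presented_group R = free_group Mod relator_closure R"

definition pres_proj :: "'g word set \<Rightarrow> 'g word set \<Rightarrow> 'g word set set" where
  "pres_proj R a = relator_closure R #>\<^bsub>free_group\<^esub> a"

section \<open>Group rings and Fox derivatives\<close>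

text \<open>Elements of the integral group ring of \<open>G\<close> are finitely supported integer-valued functions;
  \<open>ring_mult\<close> is the convolution product.\<close>

definition ring_mult ::
  "('a, 'b) monoid_scheme \<Rightarrow> ('a \<Rightarrow>\<^sub>0 int) \<Rightarrow> ('a \<Rightarrow>\<^sub>0 int) \<Rightarrow> ('a \<Rightarrow>\<^sub>0 int)" where
  "ring_mult G p q =
    (\<Sum>a\<in>Poly_Mapping.keys p. \<Sum>b\<in>Poly_Mapping.keys q.
       Poly_Mapping.single (a \<otimes>\<^bsub>G\<^esub> b) (Poly_Mapping.lookup p a * Poly_Mapping.lookup q b))"

abbreviation ring_word :: "'g word \<Rightarrow> ('g word set \<Rightarrow>\<^sub>0 int)" where
  "ring_word w \<equiv> Poly_Mapping.single (word_class w) 1"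

fun fox_letter :: "'g \<Rightarrow> 'g letter \<Rightarrow> ('g word set \<Rightarrow>\<^sub>0 int)" where
  "fox_letter g (Pos h) = (if h = g then ring_word [] else 0)"
| "fox_letter g (Neg h) = (if h = g then - ring_word [Neg h] else 0)"

text \<open>The Fox derivative with respect to the generator \<open>g\<close>, with values in the integral group ring
  of the free group, computed from the product rule
  \<open>\<partial>(l w) = \<partial>l + l \<cdot> \<partial>w\<close>.\<close>

primrec fox :: "'g \<Rightarrow> 'g word \<Rightarrow> ('g word set \<Rightarrow>\<^sub>0 int)" where
  "fox g [] = 0"
| "fox g (l # w) = fox_letter g l + ring_mult free_group (ring_word [l]) (fox g w)"

definition lin_ext :: "nat \<Rightarrow> ('a \<Rightarrow> complex mat) \<Rightarrow> ('a \<Rightarrow>\<^sub>0 int) \<Rightarrow> complex mat" where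
  "lin_ext d \<phi> p =
    mat d d (\<lambda>(i, j). \<Sum>a\<in>Poly_Mapping.keys p. of_int (Poly_Mapping.lookup p a) * \<phi> a $$ (i, j))"

section \<open>Representations\<close>

definition SL :: "nat \<Rightarrow> complex mat monoid" where
  "SL d = \<lparr>carrier = {A \<in> carrier_mat d d. det A = 1}, monoid.mult = (*), one = 1\<^sub>m d\<rparr>"

definition irreducible_rep ::
  "('a, 'b) monoid_scheme \<Rightarrow> nat \<Rightarrow> ('a \<Rightarrow> complex mat) \<Rightarrow> bool" where
  "irreducible_rep G d \<phi> \<longleftrightarrow> d > 0 \<and>
    (\<forall>W \<subseteq> carrier_vec d.
       0\<^sub>v d \<in> W \<and> (\<forall>v\<in>W. \<forall>w\<in>W. v + w \<in> W) \<and> (\<forall>c. \<forall>v\<in>W. c \<cdot>\<^sub>v v \<in> W) \<and>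
       (\<forall>a\<in>carrier G. \<forall>v\<in>W. \<phi> a *\<^sub>v v \<in> W)
       \<longrightarrow> W = {0\<^sub>v d} \<or> W = carrier_vec d)"

definition metabelian_rep :: "('a, 'b) monoid_scheme \<Rightarrow> ('a \<Rightarrow> complex mat) \<Rightarrow> bool" where
  "metabelian_rep G \<phi> \<longleftrightarrow>
    (\<forall>a\<in>derived G (carrier G). \<forall>b\<in>derived G (carrier G). \<phi> a * \<phi> b = \<phi> b * \<phi> a)"

text \<open>Polynomials in two variables \<open>x\<close>, \<open>y\<close> are polynomials in \<open>y\<close> over \<open>\<complex>[x]\<close>:
  the coefficient of \<open>x^a y^b\<close> in \<open>p\<close> is \<open>coeff (coeff p b) a\<close>.\<close>

type_synonym bipoly = "complex poly poly"

definition bi_const :: "complex \<Rightarrow> bipoly" where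
  "bi_const c = [:[:c:]:]"

definition bi_x :: bipoly where
  "bi_x = [:[:0, 1:]:]"

definition bi_y :: bipoly where
  "bi_y = [:0, 1:]"

definition bi_subst :: "bipoly \<Rightarrow> bipoly \<Rightarrow> bipoly \<Rightarrow> bipoly" where
  "bi_subst p u v = poly (map_poly (\<lambda>r. poly (map_poly bi_const r) u) p) v"

definition sl2_act :: "complex mat \<Rightarrow> bipoly \<Rightarrow> bipoly" where
  "sl2_act A p =
    (let B = inv\<^bsub>SL 2\<^esub> A in
     bi_subst p (bi_const (B $$ (0, 0)) * bi_x + bi_const (B $$ (0, 1)) * bi_y)
                (bi_const (B $$ (1, 0)) * bi_x + bi_const (B $$ (1, 1)) * bi_y))"

text \<open>The matrix of \<open>sl2_act A\<close> on the homogeneous polynomials of degree \<open>d - 1\<close>, in the basis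
  \<open>x^(d-1), x^(d-2) y, \<dots>, y^(d-1)\<close> (columns are images of basis vectors).\<close>

definition sigma :: "nat \<Rightarrow> complex mat \<Rightarrow> complex mat" where
  "sigma d A =
    mat d d (\<lambda>(j, k). coeff (coeff (sl2_act A (bi_x ^ (d - 1 - k) * bi_y ^ k)) j) (d - 1 - j))"

section \<open>The group of the double twist knot \<open>J(2m,-2n)\<close> and its Reidemeister torsion\<close>

datatype gen = X1 | X2 | Mu

text \<open>\<open>\<mu> x\<^sub>1^m \<mu>\<^sup>-\<^sup>1 x\<^sub>2 x\<^sub>1^-m\<close> and \<open>\<mu> x\<^sub>2^n x\<^sub>1 \<mu>\<^sup>-\<^sup>1 x\<^sub>2^-n\<close>\<close>

definition relator1 :: "nat \<Rightarrow> gen word" where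
  "relator1 m = [Pos Mu] @ replicate m (Pos X1) @ [Neg Mu, Pos X2] @ replicate m (Neg X1)"

definition relator2 :: "nat \<Rightarrow> gen word" where
  "relator2 n = [Pos Mu] @ replicate n (Pos X2) @ [Pos X1, Neg Mu] @ replicate n (Neg X2)"

definition knot_relators :: "nat \<Rightarrow> nat \<Rightarrow> gen word set" where
  "knot_relators m n = {relator1 m, relator2 n}"

definition knot_group :: "nat \<Rightarrow> nat \<Rightarrow> gen word set set monoid" where
  "knot_group m n = presented_group (knot_relators m n)"

definition knot_proj :: "nat \<Rightarrow> nat \<Rightarrow> gen word set \<Rightarrow> gen word set set" where
  "knot_proj m n = pres_proj (knot_relators m n)"

definition knot_gen :: "nat \<Rightarrow> nat \<Rightarrow> gen \<Rightarrow> gen word set set" where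
  "knot_gen m n g = knot_proj m n (word_class [Pos g])"

text \<open>Fox derivatives live in the group ring of the free group, so a representation \<open>\<phi>\<close> of the knot
  group is first pulled back along the projection.\<close>

definition fox_matrix ::
  "nat \<Rightarrow> nat \<Rightarrow> nat \<Rightarrow> (gen word set set \<Rightarrow> complex mat) \<Rightarrow> complex mat" where
  "fox_matrix m n d \<phi> =
    (let \<Phi> = lin_ext d (\<lambda>a. \<phi> (knot_proj m n a)) in
     four_block_mat (\<Phi> (fox X1 (relator1 m))) (\<Phi> (fox X2 (relator1 m)))
                    (\<Phi> (fox X1 (relator2 n))) (\<Phi> (fox X2 (relator2 n))))"

definition torsion_num ::
  "nat \<Rightarrow> nat \<Rightarrow> nat \<Rightarrow> (gen word set set \<Rightarrow> complex mat) \<Rightarrow> complex" where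
  "torsion_num m n d \<phi> = det (fox_matrix m n d \<phi>)"

definition torsion_den ::
  "nat \<Rightarrow> nat \<Rightarrow> nat \<Rightarrow> (gen word set set \<Rightarrow> complex mat) \<Rightarrow> complex" where
  "torsion_den m n d \<phi> =
    det (lin_ext d \<phi> (Poly_Mapping.single (knot_gen m n Mu) 1
                      - Poly_Mapping.single \<one>\<^bsub>knot_group m n\<^esub> 1))"

definition torsion_defined ::
  "nat \<Rightarrow> nat \<Rightarrow> nat \<Rightarrow> (gen word set set \<Rightarrow> complex mat) \<Rightarrow> bool" where
  "torsion_defined m n d \<phi> \<longleftrightarrow> torsion_num m n d \<phi> \<noteq> 0 \<and> torsion_den m n d \<phi> \<noteq> 0"

text \<open>The torsion is only defined up to sign; this is one of the two values.\<close>

definition torsion ::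
  "nat \<Rightarrow> nat \<Rightarrow> nat \<Rightarrow> (gen word set set \<Rightarrow> complex mat) \<Rightarrow> complex" where
  "torsion m n d \<phi> = torsion_num m n d \<phi> / torsion_den m n d \<phi>"

definition mat2 :: "complex \<Rightarrow> complex \<Rightarrow> complex \<Rightarrow> complex \<Rightarrow> complex mat" where
  "mat2 a b c d = mat_of_rows_list 2 [[a, b], [c, d]]"

text \<open>\<open>\<rho>\<close> is the representation \<open>\<rho>\<^sub>i\<close>, for \<open>\<xi>\<close> a root of unity of order \<open>4mn+1\<close>.\<close>

definition is_rho ::
  "nat \<Rightarrow> nat \<Rightarrow> complex \<Rightarrow> nat \<Rightarrow> (gen word set set \<Rightarrow> complex mat) \<Rightarrow> bool" where
  "is_rho m n \<xi> i \<rho> \<longleftrightarrow>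
     \<rho> \<in> hom (knot_group m n) (SL 2) \<and>
     \<rho> (knot_gen m n X1) = mat2 (\<xi> powi int i) 0 0 (\<xi> powi (- int i)) \<and>
     \<rho> (knot_gen m n X2) = mat2 (\<xi> powi int (2 * m * i)) 0 0 (\<xi> powi (- int (2 * m * i))) \<and>
     \<rho> (knot_gen m n Mu) = mat2 0 1 (-1) 0"

section \<open>Existence of the representations \<open>\<rho>\<^sub>i\<close>\<close>

lemma equiv_free_rel: "equiv UNIV (free_rel :: ('g word \<times> 'g word) set)"
  unfolding free_rel_def
  by (intro equivI refl_onI symI transI) (auto intro: equivclp_sym equivclp_trans)

lemma word_class_eq_iff: "word_class u = word_class v \<longleftrightarrow> equivclp free_step u v"
  unfolding word_class_def using equiv_class_eq_iff[OF equiv_free_rel, of u v]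
  by (simp add: free_rel_def)

lemma free_step_append: "free_step u v \<Longrightarrow> free_step (a @ u @ b) (a @ v @ b)"
proof (induction rule: free_step.induct)
  case (1 u l v)
  show ?case using free_step.intros[of "a @ u" l "v @ b"] by simp
qed

lemma equivclp_append:
  assumes "equivclp free_step u v" shows "equivclp free_step (a @ u @ b) (a @ v @ b)"
  using assms
proof (induction rule: equivclp_induct)
  case base
  then show ?case by simp
next
  case (step y z)
  then have "free_step (a @ y @ b) (a @ z @ b) \<or> free_step (a @ z @ b) (a @ y @ b)"
    using free_step_append by blast
  with step.IH show ?case by (meson equivclp_into_equivclp)
qed

lemma free_mult: "word_class u \<otimes>\<^bsub>free_group\<^esub> word_class v = word_class (u @ v)"
proof -
  have "word_class (a @ b) = word_class (u @ v)" if "a \<in> word_class u" "b \<in> word_class v" for a b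
  proof -
    from that have "equivclp free_step u a" "equivclp free_step v b"
      by (auto simp: word_class_def free_rel_def)
    then have "equivclp free_step (u @ v) (a @ v)" "equivclp free_step (a @ v) (a @ b)"
      using equivclp_append[of u a "[]" v] equivclp_append[of v b a "[]"] by auto
    then show ?thesis
      by (metis word_class_eq_iff)
  qed
  then have "(\<Union>a\<in>word_class u. \<Union>b\<in>word_class v. word_class (a @ b)) =
      (\<Union>a\<in>word_class u. \<Union>b\<in>word_class v. word_class (u @ v))"
    by simp
  moreover have "u \<in> word_class u" "v \<in> word_class v"
    by (auto simp: word_class_def free_rel_def)
  ultimately have "(\<Union>a\<in>word_class u. \<Union>b\<in>word_class v. word_class (a @ b)) = word_class (u @ v)"
    by auto
  then show ?thesis
    by (simp add: free_group_def)
qed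

lemma free_carrier: "carrier free_group = range word_class"
  by (auto simp: free_group_def quotient_def word_class_def)

lemma free_one: "\<one>\<^bsub>free_group\<^esub> = word_class []"
  by (simp add: free_group_def)

lemma inv_letter_inv_letter [simp]: "inv_letter (inv_letter l) = l"
  by (cases l) auto

lemma word_class_cancel: "word_class (u @ l # inv_letter l # v) = word_class (u @ v)"
  unfolding word_class_eq_iff using free_step.intros[of u l v] by auto

lemma word_class_inverse: "word_class (rev (map inv_letter w) @ w) = word_class []"
proof (induction w)
  case (Cons l w)
  then show ?case
    using word_class_cancel[of "rev (map inv_letter w)" "inv_letter l" w] by simp
qed simp

lemma group_free_group: "group (free_group :: 'g word set monoid)"
proof (rule groupI)
  fix x :: "'g word set" assume "x \<in> carrier free_group"
  then obtain w where "x = word_class w" by (auto simp: free_carrier)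
  then show "\<exists>y\<in>carrier free_group. y \<otimes>\<^bsub>free_group\<^esub> x = \<one>\<^bsub>free_group\<^esub>"
    by (intro bexI[of _ "word_class (rev (map inv_letter w))"])
       (auto simp: free_mult free_one free_carrier word_class_inverse)
qed (auto simp: free_carrier free_mult free_one)

lemma normal_closure_normal:
  assumes "group G" "S \<subseteq> carrier G" shows "normal_closure G S \<lhd> G"
proof -
  interpret group G by fact
  let ?M = "{N. N \<lhd> G \<and> S \<subseteq> N}"
  have "carrier G \<lhd> G"
    using subgroup_self by (auto simp: normal_inv_iff)
  then have ne: "?M \<noteq> {}" using assms(2) by blast
  have "subgroup (\<Inter>?M) G"
    by (rule subgroups_Inter[OF _ ne]) (auto simp: normal_inv_iff)
  then show ?thesis
    unfolding normal_closure_def by (auto simp: normal_inv_iff)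
qed

lemma relator_closure_normal: "relator_closure R \<lhd> free_group"
  unfolding relator_closure_def
  by (rule normal_closure_normal[OF group_free_group]) (auto simp: free_carrier)

lemma group_presented_group: "group (presented_group R)"
  unfolding presented_group_def by (rule normal.factorgroup_is_group[OF relator_closure_normal])

lemma pres_proj_hom: "pres_proj R \<in> hom free_group (presented_group R)"
  using normal.r_coset_hom_Mod[OF relator_closure_normal, of R]
  by (simp add: pres_proj_def[abs_def] presented_group_def)

lemma presented_group_carrier:
  "carrier (presented_group R) = range (\<lambda>w. pres_proj R (word_class w))"
  by (auto simp: presented_group_def FactGroup_def RCOSETS_def free_carrier pres_proj_def)

primrec word_eval :: "('a, 'b) monoid_scheme \<Rightarrow> ('g \<Rightarrow> 'a) \<Rightarrow> 'g word \<Rightarrow> 'a" where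
  "word_eval H f [] = \<one>\<^bsub>H\<^esub>"
| "word_eval H f (l # w) =
     (case l of Pos g \<Rightarrow> f g | Neg g \<Rightarrow> inv\<^bsub>H\<^esub> f g) \<otimes>\<^bsub>H\<^esub> word_eval H f w"

text \<open>The universal property of a group presentation.\<close>

lemma presented_group_universal:
  assumes "group H" and f: "\<And>g. f g \<in> carrier H"
    and R: "\<And>r. r \<in> R \<Longrightarrow> word_eval H f r = \<one>\<^bsub>H\<^esub>"
  obtains \<phi> where "\<phi> \<in> hom (presented_group R) H"
    and "\<And>w. \<phi> (pres_proj R (word_class w)) = word_eval H f w"
proof -
  interpret H: group H by fact
  let ?l = "\<lambda>l. case l of Pos g \<Rightarrow> f g | Neg g \<Rightarrow> inv\<^bsub>H\<^esub> f g"
  have l: "?l l \<in> carrier H" for l using f by (cases l) auto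
  have c: "word_eval H f w \<in> carrier H" for w
    by (induction w) (auto simp: l)
  have app: "word_eval H f (u @ v) = word_eval H f u \<otimes>\<^bsub>H\<^esub> word_eval H f v" for u v
    by (induction u) (auto simp: l c H.m_assoc)
  have il: "?l l \<otimes>\<^bsub>H\<^esub> (?l (inv_letter l) \<otimes>\<^bsub>H\<^esub> x) = x" if "x \<in> carrier H" for l x
    using f that by (cases l) (auto simp: H.m_assoc[symmetric])
  have st: "word_eval H f u = word_eval H f v" if "free_step u v" for u v
    using that
  proof (induction rule: free_step.induct)
    case (1 u l v)
    have "word_eval H f ([l, inv_letter l] @ v) = word_eval H f v"
      using il[OF c[of v], of l] by simp
    then show ?case by (simp only: app)
  qed
  have eq: "word_eval H f u = word_eval H f v" if "equivclp free_step u v" for u v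
    using that by (induction rule: equivclp_induct) (auto dest: st)
  define h where "h = (\<lambda>A. word_eval H f (SOME w. w \<in> A))"
  have h: "h (word_class w) = word_eval H f w" for w
  proof -
    have "w \<in> word_class w" by (auto simp: word_class_def free_rel_def)
    then have "(SOME w'. w' \<in> word_class w) \<in> word_class w" by (rule someI)
    then have "equivclp free_step w (SOME w'. w' \<in> word_class w)"
      by (simp add: word_class_def free_rel_def)
    then show ?thesis unfolding h_def using eq by metis
  qed
  have hom: "h \<in> hom free_group H"
    by (rule homI) (auto simp: free_carrier h c free_mult app)
  interpret gh: group_hom free_group H h
    by (intro group_hom.intro group_free_group \<open>group H\<close> group_hom_axioms.intro hom)
  have "word_class ` R \<subseteq> kernel free_group H h"
    by (auto simp: kernel_def free_carrier h R)
  then have "relator_closure R \<subseteq> kernel free_group H h"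
    unfolding relator_closure_def normal_closure_def using gh.normal_kernel by blast
  then obtain \<phi> where \<phi>: "\<phi> \<in> hom (free_group Mod relator_closure R) H"
    "\<And>x. x \<in> carrier free_group \<Longrightarrow> \<phi> (relator_closure R #>\<^bsub>free_group\<^esub> x) = h x"
    using gh.FactGroup_universal_kernel[OF relator_closure_normal] by metis
  show thesis
    using \<phi> by (intro that[of \<phi>]) (auto simp: presented_group_def pres_proj_def free_carrier h)
qed

lemma group_SL: "group (SL d)"
proof (rule groupI)
  fix A assume A: "A \<in> carrier (SL d)"
  then have Ac: "A \<in> carrier_mat d d" and dA: "det A = 1" by (auto simp: SL_def)
  have adj: "adj_mat A \<in> carrier_mat d d" "adj_mat A * A = 1\<^sub>m d"
    using adj_mat[OF Ac] dA by auto
  have "det (adj_mat A) = 1"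
    using det_mult[OF adj(1) Ac] dA adj(2) by simp
  with adj show "\<exists>B\<in>carrier (SL d). B \<otimes>\<^bsub>SL d\<^esub> A = \<one>\<^bsub>SL d\<^esub>"
    by (auto simp: SL_def)
qed (auto simp: SL_def det_mult assoc_mult_mat)

lemma mat2_carrier [simp]: "mat2 a b c d \<in> carrier_mat 2 2"
  by (auto simp: mat2_def mat_of_rows_list_def)

lemma mat2_dim [simp]: "dim_row (mat2 a b c d) = 2" "dim_col (mat2 a b c d) = 2"
  by (auto simp: mat2_def mat_of_rows_list_def)

lemma mat2_index [simp]:
  "mat2 a b c d $$ (0, 0) = a" "mat2 a b c d $$ (0, Suc 0) = b"
  "mat2 a b c d $$ (Suc 0, 0) = c" "mat2 a b c d $$ (Suc 0, Suc 0) = d"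
  by (auto simp: mat2_def mat_of_rows_list_def)

lemma mat2_eqI:
  assumes "A \<in> carrier_mat 2 2" "A $$ (0,0) = a" "A $$ (0,Suc 0) = b"
    "A $$ (Suc 0,0) = c" "A $$ (Suc 0,Suc 0) = d"
  shows "A = mat2 a b c d"
proof (rule eq_matI)
  fix i j assume "i < dim_row (mat2 a b c d)" "j < dim_col (mat2 a b c d)"
  then have "i = 0 \<or> i = Suc 0" "j = 0 \<or> j = Suc 0" by auto
  then show "A $$ (i, j) = mat2 a b c d $$ (i, j)" using assms by auto
qed (use assms in auto)

lemma mat2_mult:
  "mat2 a b c d * mat2 a' b' c' d' =
   mat2 (a * a' + b * c') (a * b' + b * d') (c * a' + d * c') (c * b' + d * d')"
  by (rule mat2_eqI) (auto simp: scalar_prod_def numeral_2_eq_2)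

lemma mat2_one: "1\<^sub>m 2 = mat2 1 0 0 1"
  by (rule mat2_eqI) auto

lemma mat2_det: "det (mat2 a b c d) = a * d - b * c"
proof -
  have 1: "det (mat_delete (mat2 a b c d) 0 0) = d"
    by (subst det_single) (auto simp: mat_delete_def)
  have 2: "det (mat_delete (mat2 a b c d) 0 (Suc 0)) = c"
    by (subst det_single) (auto simp: mat_delete_def)
  show ?thesis
    using laplace_expansion_row[OF mat2_carrier, of 0 a b c d]
    by (simp add: numeral_2_eq_2 cofactor_def 1 2)
qed


lemma word_eval_closed:
  assumes "group H" "\<And>g. f g \<in> carrier H"
  shows "word_eval H f w \<in> carrier H"
proof -
  interpret group H by fact
  show ?thesis using assms(2) by (induction w) (auto split: letter.split)
qed

lemma word_eval_append:
  assumes "group H" "\<And>g. f g \<in> carrier H"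
  shows "word_eval H f (u @ v) = word_eval H f u \<otimes>\<^bsub>H\<^esub> word_eval H f v"
proof -
  interpret group H by fact
  show ?thesis
    using assms(2) word_eval_closed[OF assms(1), of f, OF assms(2)]
    by (induction u) (auto simp: m_assoc split: letter.split)
qed

definition diag2 :: "complex \<Rightarrow> complex mat" where
  "diag2 a = mat2 a 0 0 (inverse a)"

definition anti2 :: "complex \<Rightarrow> complex mat" where
  "anti2 a = mat2 0 a (- inverse a) 0"

lemma diag_anti_mult:
  "diag2 a * diag2 b = diag2 (a * b)"
  "diag2 a * anti2 b = anti2 (a * b)"
  "anti2 a * diag2 b = anti2 (a * inverse b)"
  "anti2 a * anti2 b = diag2 (- a * inverse b)"
  by (auto simp: diag2_def anti2_def mat2_mult)

lemma diag_anti_carrier: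
  assumes "a \<noteq> 0" shows "diag2 a \<in> carrier (SL 2)" "anti2 a \<in> carrier (SL 2)"
  using assms by (auto simp: diag2_def anti2_def SL_def mat2_det)

lemma SL_simps: "\<one>\<^bsub>SL d\<^esub> = 1\<^sub>m d" "A \<otimes>\<^bsub>SL d\<^esub> B = A * B"
  by (auto simp: SL_def)

lemma diag2_one: "diag2 1 = 1\<^sub>m 2"
  by (simp add: diag2_def mat2_one)

lemma diag_anti_inv:
  assumes "a \<noteq> 0"
  shows "inv\<^bsub>SL 2\<^esub> diag2 a = diag2 (inverse a)" "inv\<^bsub>SL 2\<^esub> anti2 a = anti2 (- a)"
  using assms
  by (auto intro!: group.inv_equality[OF group_SL] diag_anti_carrier
           simp: SL_simps diag_anti_mult diag2_one)

lemma word_eval_diag: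
  assumes "f g = diag2 a" "a \<noteq> 0"
  shows "word_eval (SL 2) f (replicate k (Pos g)) = diag2 (a ^ k)"
    "word_eval (SL 2) f (replicate k (Neg g)) = diag2 (inverse a ^ k)"
  by (induction k) (auto simp: assms SL_simps diag2_one diag_anti_inv diag_anti_mult)

lemma monomial_word:
  assumes "\<And>g. \<exists>a. a \<noteq> 0 \<and> (f g = diag2 a \<or> f g = anti2 a)"
  shows "\<exists>a. a \<noteq> 0 \<and> (word_eval (SL 2) f w = diag2 a \<or> word_eval (SL 2) f w = anti2 a)"
proof (induction w)
  case Nil
  then show ?case by (auto intro!: exI[of _ 1] simp: SL_simps diag2_one)
next
  case (Cons l w)
  have "\<exists>a. a \<noteq> 0 \<and> (word_eval (SL 2) f [l] = diag2 a \<or> word_eval (SL 2) f [l] = anti2 a)"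
  proof (cases l)
    case (Pos g)
    obtain a where a: "a \<noteq> 0" "f g = diag2 a \<or> f g = anti2 a" using assms by blast
    then show ?thesis
      by (intro exI[of _ a]) (auto simp: Pos SL_simps diag_anti_mult simp flip: diag2_one)
  next
    case (Neg g)
    obtain a where a: "a \<noteq> 0" "f g = diag2 a \<or> f g = anti2 a" using assms by blast
    from a(2) show ?thesis
    proof
      assume "f g = diag2 a"
      with a(1) show ?thesis
        by (intro exI[of _ "inverse a"])
           (auto simp: Neg SL_simps diag_anti_mult diag_anti_inv simp flip: diag2_one)
    next
      assume "f g = anti2 a"
      with a(1) show ?thesis
        by (intro exI[of _ "- a"])
           (auto simp: Neg SL_simps diag_anti_mult diag_anti_inv simp flip: diag2_one)
    qed
  qed
  then obtain a where a: "a \<noteq> 0" "word_eval (SL 2) f [l] = diag2 a \<or> word_eval (SL 2) f [l] = anti2 a"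
    by blast
  obtain b where b: "b \<noteq> 0" "word_eval (SL 2) f w = diag2 b \<or> word_eval (SL 2) f w = anti2 b"
    using Cons.IH by blast
  have eq: "word_eval (SL 2) f (l # w) = word_eval (SL 2) f [l] * word_eval (SL 2) f w"
    using word_eval_append[OF group_SL, of f 2 "[l]" w] assms
    by (metis SL_simps(2) append_Cons append_Nil diag_anti_carrier)
  have "a * b \<noteq> 0" "a * inverse b \<noteq> 0" "- a * inverse b \<noteq> 0" using a(1) b(1) by auto
  with a(2) b(2) show ?case unfolding eq by (elim disjE) (metis diag_anti_mult)+
qed

lemma irreducible_diag_anti:
  assumes "a \<in> carrier G" "b \<in> carrier G" "\<phi> a = diag2 z" "\<phi> b = anti2 1" "z \<noteq> 0" "z \<noteq> inverse z"
  shows "irreducible_rep G 2 \<phi>"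
  unfolding irreducible_rep_def
proof (intro conjI allI impI)
  fix W assume WC: "W \<subseteq> carrier_vec 2" and "0\<^sub>v 2 \<in> W \<and> (\<forall>v\<in>W. \<forall>w\<in>W. v + w \<in> W) \<and>
    (\<forall>c. \<forall>v\<in>W. c \<cdot>\<^sub>v v \<in> W) \<and> (\<forall>a\<in>carrier G. \<forall>v\<in>W. \<phi> a *\<^sub>v v \<in> W)"
  then have W0: "0\<^sub>v 2 \<in> W" and add: "\<And>v w. v \<in> W \<Longrightarrow> w \<in> W \<Longrightarrow> v + w \<in> W"
    and smul: "\<And>c v. v \<in> W \<Longrightarrow> c \<cdot>\<^sub>v v \<in> W"
    and D: "\<And>v. v \<in> W \<Longrightarrow> diag2 z *\<^sub>v v \<in> W" and A: "\<And>v. v \<in> W \<Longrightarrow> anti2 1 *\<^sub>v v \<in> W"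
    using assms(1-4) by (metis, metis, metis, metis, metis)
  define v2 :: "complex \<Rightarrow> complex \<Rightarrow> complex vec"
    where "v2 = (\<lambda>s t. vec 2 (\<lambda>k. if k = 0 then s else t))"
  have v2: "v = v2 (v $ 0) (v $ 1)" if "v \<in> carrier_vec 2" for v
    using that by (intro eq_vecI) (auto simp: v2_def less_2_cases_iff)
  have m2: "mat2 a b c d *\<^sub>v v2 s t = v2 (a * s + b * t) (c * s + d * t)" for a b c d s t
    by (intro eq_vecI) (auto simp: v2_def scalar_prod_def numeral_2_eq_2 less_Suc_eq)
  have add2: "v2 s t + v2 s' t' = v2 (s + s') (t + t')" for s t s' t'
    by (intro eq_vecI) (auto simp: v2_def)
  have smul2: "c \<cdot>\<^sub>v v2 s t = v2 (c * s) (c * t)" for c s t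
    by (intro eq_vecI) (auto simp: v2_def)
  show "W = {0\<^sub>v 2} \<or> W = carrier_vec 2"
  proof (rule disjCI)
    assume "W \<noteq> carrier_vec 2"
    have no: False if "v2 s 0 \<in> W" "s \<noteq> 0" for s
    proof -
      have "carrier_vec 2 \<subseteq> W"
      proof
        fix v :: "complex vec" assume "v \<in> carrier_vec 2"
        then have v: "v = v2 (v $ 0) (v $ 1)" by (rule v2)
        have "anti2 1 *\<^sub>v v2 s 0 \<in> W" using A that by blast
        then have 0: "v2 0 (- s) \<in> W" by (simp add: anti2_def m2)
        have "(v $ 0 / s) \<cdot>\<^sub>v v2 s 0 + (- (v $ 1) / s) \<cdot>\<^sub>v v2 0 (- s) \<in> W"
          using add smul that(1) 0 by blast
        also have "(v $ 0 / s) \<cdot>\<^sub>v v2 s 0 + (- (v $ 1) / s) \<cdot>\<^sub>v v2 0 (- s) = v"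
          using that(2) by (subst (3) v) (simp add: smul2 add2)
        finally show "v \<in> W" .
      qed
      with WC \<open>W \<noteq> carrier_vec 2\<close> show False by blast
    qed
    have "v = 0\<^sub>v 2" if vW: "v \<in> W" for v
    proof -
      obtain s t where v: "v = v2 s t" using v2[of v] WC vW by blast
      have "diag2 z *\<^sub>v v2 s t + (- inverse z) \<cdot>\<^sub>v v2 s t \<in> W"
        using add D smul vW v by blast
      then have "v2 ((z - inverse z) * s) 0 \<in> W"
        by (simp add: diag2_def m2 smul2 add2 algebra_simps)
      then have s: "s = 0" using no assms(6) by force
      have "anti2 1 *\<^sub>v v2 s t \<in> W" using A vW v by blast
      then have "v2 t 0 \<in> W" by (simp add: anti2_def m2 s)
      then have "t = 0" using no by blast
      with s v show ?thesis by (auto simp: v2_def)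
    qed
    with W0 show "W = {0\<^sub>v 2}" by blast
  qed
qed simp

lemma metabelian_diag_anti:
  assumes "group G" "\<phi> \<in> hom G (SL 2)"
    and mono: "\<And>x. x \<in> carrier G \<Longrightarrow> \<exists>a. a \<noteq> 0 \<and> (\<phi> x = diag2 a \<or> \<phi> x = anti2 a)"
  shows "metabelian_rep G \<phi>"
proof -
  interpret G: group G by fact
  interpret \<phi>: group_hom G "SL 2" \<phi>
    by (intro group_hom.intro assms group_SL group_hom_axioms.intro)
  have ex: "\<exists>c. c \<noteq> 0 \<and> diag2 d = diag2 c" if "d \<noteq> 0" for d
    using that by blast
  have "\<exists>a. a \<noteq> 0 \<and> \<phi> x = diag2 a" if "x \<in> derived G (carrier G)" for x
    using that unfolding derived_def
  proof (induction rule: generate.induct)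
    case one
    then show ?case using \<phi>.hom_one by (auto intro!: exI[of _ 1] simp: SL_simps diag2_one)
  next
    case (incl h)
    then obtain x y where xy: "x \<in> carrier G" "y \<in> carrier G"
      "h = x \<otimes>\<^bsub>G\<^esub> y \<otimes>\<^bsub>G\<^esub> inv\<^bsub>G\<^esub> x \<otimes>\<^bsub>G\<^esub> inv\<^bsub>G\<^esub> y" by blast
    obtain a b where "a \<noteq> 0" "\<phi> x = diag2 a \<or> \<phi> x = anti2 a"
      "b \<noteq> 0" "\<phi> y = diag2 b \<or> \<phi> y = anti2 b"
      using mono xy by meson
    then show ?case
      by (elim disjE)
         (auto simp: xy SL_simps diag_anti_inv diag_anti_mult intro!: ex)
  next
    case (inv h)
    then obtain x y where xy: "x \<in> carrier G" "y \<in> carrier G"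
      "h = x \<otimes>\<^bsub>G\<^esub> y \<otimes>\<^bsub>G\<^esub> inv\<^bsub>G\<^esub> x \<otimes>\<^bsub>G\<^esub> inv\<^bsub>G\<^esub> y" by blast
    obtain a b where ab: "a \<noteq> 0" "\<phi> x = diag2 a \<or> \<phi> x = anti2 a"
      "b \<noteq> 0" "\<phi> y = diag2 b \<or> \<phi> y = anti2 b"
      using mono xy by meson
    then have "\<exists>a. a \<noteq> 0 \<and> \<phi> h = diag2 a"
      by (elim disjE)
         (auto simp: xy SL_simps diag_anti_inv diag_anti_mult intro!: ex)
    moreover have "h \<in> carrier G" using xy by simp
    ultimately show ?case by (metis \<phi>.hom_inv diag_anti_inv(1) inverse_nonzero_iff_nonzero)
  next
    case (eng h1 h2)
    have "h1 \<in> carrier G" "h2 \<in> carrier G"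
      using eng.hyps G.generate_in_carrier[OF G.derived_set_in_carrier[OF subset_refl]] by auto
    with eng.IH show ?case by (auto simp: SL_simps diag_anti_mult intro!: ex)
  qed
  then show ?thesis
    unfolding metabelian_rep_def by (metis diag_anti_mult(1) mult.commute)
qed

lemma group_knot_group: "group (knot_group m n)"
  unfolding knot_group_def by (rule group_presented_group)

lemma knot_gen_carrier: "knot_gen m n g \<in> carrier (knot_group m n)"
  by (simp add: knot_gen_def knot_proj_def knot_group_def presented_group_carrier)

text \<open>The prescribed values on the generators do define a representation of the knot group, and it
  is irreducible and metabelian.\<close>

lemma rho_exists:
  assumes "\<xi> = exp (2 * of_real pi * \<i> / of_nat (4 * m * n + 1))" "1 \<le> i" "i \<le> 2 * m * n"
  shows "\<exists>\<rho>. is_rho m n \<xi> i \<rho> \<and> irreducible_rep (knot_group m n) 2 \<rho> \<and>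
    metabelian_rep (knot_group m n) \<rho>"
proof -
  define Q where "Q = 4 * m * n + 1"
  define \<theta> where "\<theta> = 2 * pi * real i / real Q"
  define z where "z = \<xi> ^ i"
  have Q: "2 * i < Q" "Q > 0" using assms by (auto simp: Q_def)
  have \<xi>: "\<xi> = cis (2 * pi / real Q)"
    by (simp add: assms(1) cis_conv_exp Q_def mult_ac)
  have \<xi>Q: "\<xi> ^ Q = 1" using Q by (simp add: \<xi> DeMoivre)
  have z0: "z \<noteq> 0" by (simp add: z_def \<xi>)
  have zQ: "z ^ Q = 1"
    by (metis \<xi>Q z_def power_mult mult.commute power_one)
  have zcis: "z = cis \<theta>" by (simp add: z_def \<xi> DeMoivre \<theta>_def mult_ac)
  have "2 * real i < real Q" using Q by linarith
  then have "2 * pi * real i < pi * real Q" by simp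
  then have "0 < \<theta>" "\<theta> < pi" using Q assms(2) by (auto simp: \<theta>_def divide_less_eq)
  then have "cos \<theta> \<noteq> 1" using cos_monotone_0_pi[of 0 \<theta>] by simp
  then have z1: "z \<noteq> 1" by (auto simp: zcis complex_eq_iff)
  have zi: "z \<noteq> inverse z"
  proof
    assume "z = inverse z"
    then have "z ^ 2 = 1" using z0 by (metis power2_eq_square right_inverse)
    then have "z ^ (2 * (2 * m * n)) = 1" by (simp only: power_mult power_one)
    moreover have "z ^ Q = z ^ (2 * (2 * m * n)) * z" by (simp add: Q_def mult.assoc)
    ultimately show False using zQ z1 by simp
  qed
  define f where "f = (\<lambda>g. case g of X1 \<Rightarrow> diag2 z | X2 \<Rightarrow> diag2 (z ^ (2 * m)) | Mu \<Rightarrow> anti2 1)"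
  have mono: "\<exists>a. a \<noteq> 0 \<and> (f g = diag2 a \<or> f g = anti2 a)" for g
    using z0
    by (cases g) (auto simp: f_def intro: exI[of _ z] exI[of _ "z ^ (2 * m)"] exI[of _ 1])
  have fc: "f g \<in> carrier (SL 2)" for g using mono diag_anti_carrier by metis
  note app = word_eval_append[OF group_SL fc] and ev = word_eval_diag[of f]
  have fX: "f X1 = diag2 z" "f X2 = diag2 (z ^ (2 * m))" "f Mu = anti2 1" by (auto simp: f_def)
  have one: "1\<^sub>m 2 = diag2 1" by (simp add: diag2_one)
  have "inverse w * (w * w * inverse w) = 1" if "w \<noteq> 0" for w :: complex
    using that by (simp add: field_simps)
  then have p1: "inverse (z ^ m) * (z ^ m * z ^ m * inverse (z ^ m)) = 1" using z0 by simp
  have r1: "word_eval (SL 2) f (relator1 m) = \<one>\<^bsub>SL 2\<^esub>"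
    unfolding relator1_def app using z0
    by (simp add: fX ev[OF fX(1)] SL_simps one diag_anti_inv diag_anti_mult mult_2 power_add
        power_inverse p1)
  define w where "w = z ^ (2 * m * n)"
  have "w * (z * w) = z ^ Q"
    by (simp add: w_def Q_def mult.assoc flip: power_add power_Suc power_Suc2)
  then have wz: "w * (z * w) = 1" "w * z * w = 1" using zQ by (auto simp: mult.assoc)
  have ew: "word_eval (SL 2) f (replicate n (Pos X2)) = diag2 w"
    "word_eval (SL 2) f (replicate n (Neg X2)) = diag2 (inverse w)"
    using z0 by (simp_all add: ev[OF fX(2)] w_def power_inverse power_mult)
  have r2: "word_eval (SL 2) f (relator2 n) = \<one>\<^bsub>SL 2\<^esub>"
    unfolding relator2_def app ew
    by (simp add: fX SL_simps one diag_anti_inv diag_anti_mult wz)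
  obtain \<rho> where \<rho>: "\<rho> \<in> hom (knot_group m n) (SL 2)"
    "\<And>w. \<rho> (knot_proj m n (word_class w)) = word_eval (SL 2) f w"
    using presented_group_universal[where R = "knot_relators m n" and f = f and H = "SL 2",
        OF group_SL fc] r1 r2
    unfolding knot_group_def knot_proj_def knot_relators_def by auto
  have g: "\<rho> (knot_gen m n g) = f g" for g
    using fc[of g] group.is_monoid[OF group_SL] by (simp add: knot_gen_def \<rho>(2) monoid.r_one)
  have p: "\<xi> powi int k = \<xi> ^ k" "\<xi> powi (- int k) = inverse (\<xi> ^ k)" for k
    by (auto simp: power_int_minus)
  have z2: "z ^ (2 * m) = \<xi> ^ (2 * m * i)"
    by (simp add: z_def mult_ac flip: power_mult)
  have "is_rho m n \<xi> i \<rho>"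
    unfolding is_rho_def p g fX z2 using \<rho>(1) by (simp add: diag2_def anti2_def z_def)
  moreover have "irreducible_rep (knot_group m n) 2 \<rho>"
    by (rule irreducible_diag_anti[where z = z,
          OF knot_gen_carrier[of m n X1] knot_gen_carrier[of m n Mu]])
       (use z0 zi in \<open>auto simp: g fX\<close>)
  moreover have "metabelian_rep (knot_group m n) \<rho>"
  proof (rule metabelian_diag_anti[OF group_knot_group \<rho>(1)])
    fix x assume "x \<in> carrier (knot_group m n)"
    then obtain w where "x = knot_proj m n (word_class w)"
      by (auto simp: knot_group_def knot_proj_def presented_group_carrier)
    then show "\<exists>a. a \<noteq> 0 \<and> (\<rho> x = diag2 a \<or> \<rho> x = anti2 a)"
      using monomial_word[of f w] mono \<rho>(2) by simp
  qed
  ultimately show ?thesis by blast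
qed

text \<open>\<open>bi_subst\<close> substitutes \<open>u\<close> for \<open>x\<close> and \<open>v\<close> for \<open>y\<close>.\<close>

lemma bi_subst_monomial: "bi_subst (bi_x ^ a * bi_y ^ b) u v = u ^ a * v ^ b"
proof -
  have x: "bi_x ^ a = [:monom 1 a:]"
    by (induction a) (auto simp: bi_x_def monom_Suc one_pCons)
  have y: "bi_y ^ b = monom 1 b"
    by (induction b) (auto simp: bi_y_def monom_Suc monom_0 simp flip: one_pCons)
  have c: "bi_const 0 = 0" "bi_const 1 = 1" by (auto simp: bi_const_def one_pCons)
  have xy: "bi_x ^ a * bi_y ^ b = monom (monom 1 a) b"
    by (simp add: x y smult_monom)
  have "poly (map_poly bi_const (monom 1 a)) u = u ^ a"
    by (simp add: map_poly_monom c poly_monom)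
  moreover have "poly (map_poly bi_const 0) u = 0" by simp
  ultimately show ?thesis
    unfolding bi_subst_def xy by (simp add: map_poly_monom poly_monom)
qed

end

theory Submission
  imports
    Defs
    "HOL-Number_Theory.Cong"
begin

text \<open>In the monomial basis of the homogeneous polynomials of degree \<open>2N - 1\<close>, the images of
  \<open>x\<^sub>1\<close> and \<open>x\<^sub>2\<close> are diagonal and that of \<open>\<mu>\<close> is antidiagonal. The span of
  the \<open>k\<close>-th vector from the front and the \<open>k\<close>-th from the back is thus invariant, and the torsion is
  a product over \<open>k < N\<close> of factors \<open>P(t)/2\<close>, where \<open>t = \<xi>^(\<plusminus>(2k+1)i)\<close> is the eigenvalue of \<open>x\<^sub>1\<close>.
  Put \<open>h = t^m\<close> and \<open>g = t^(2mn)\<close>. Since \<open>t g\<^sup>2 = 1\<close>, one finds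
  \<open>|P(t)| = 4 (|1 - h| |1 - g| / (|1 - t| |1 - h\<^sup>2|))\<^sup>2\<close> for \<open>t \<noteq> 1\<close>, while \<open>P(1) = (2mn + 1)\<^sup>2\<close>.
  The logarithm of the torsion is therefore a sum of a function of \<open>k\<close> of period \<open>q\<close>. Over one period
  \<open>t\<close> runs through all \<open>q\<close>-th roots of unity, and so do \<open>h\<close>, \<open>g\<close> and \<open>h\<^sup>2\<close> because the exponents are
  prime to \<open>q\<close>; hence the logarithms of the four distances to 1 cancel and only the constants remain.\<close>

section \<open>Matrices supported on the two diagonals\<close>

text \<open>Both functions are indexed by the column: column \<open>j\<close> is \<open>f j\<close>
  times the \<open>j\<close>-th plus \<open>g j\<close> times the \<open>(d - 1 - j)\<close>-th
  basis vector. In the middle column of an odd dimension the two entries add up, which keeps the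
  product formula valid for every \<open>d\<close>.\<close>

definition pair_mat :: "nat \<Rightarrow> (nat \<Rightarrow> complex) \<Rightarrow> (nat \<Rightarrow> complex) \<Rightarrow> complex mat" where
  "pair_mat d f g = mat d d (\<lambda>(i, j). (if i = j then f j else 0) + (if i + j + 1 = d then g j else 0))"

lemma pair_mat_carrier [simp]: "pair_mat d f g \<in> carrier_mat d d"
  by (simp add: pair_mat_def)

lemma pair_mat_dim [simp]: "dim_row (pair_mat d f g) = d" "dim_col (pair_mat d f g) = d"
  by (simp_all add: pair_mat_def)

lemma pair_mat_cong:
  assumes "\<And>j. j < d \<Longrightarrow> f j = f' j" "\<And>j. j < d \<Longrightarrow> g j = g' j"
  shows "pair_mat d f g = pair_mat d f' g'"
  using assms by (intro eq_matI) (auto simp: pair_mat_def)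

lemma pair_mat_add:
  "pair_mat d f g + pair_mat d f' g' = pair_mat d (\<lambda>j. f j + f' j) (\<lambda>j. g j + g' j)"
  by (intro eq_matI) (auto simp: pair_mat_def)

lemma pair_mat_minus:
  "pair_mat d f g - pair_mat d f' g' = pair_mat d (\<lambda>j. f j - f' j) (\<lambda>j. g j - g' j)"
  by (intro eq_matI) (auto simp: pair_mat_def)

lemma pair_mat_uminus: "- pair_mat d f g = pair_mat d (\<lambda>j. - f j) (\<lambda>j. - g j)"
  by (intro eq_matI) (auto simp: pair_mat_def)

lemma one_pair_mat: "1\<^sub>m d = pair_mat d (\<lambda>_. 1) (\<lambda>_. 0)"
  by (intro eq_matI) (auto simp: pair_mat_def)

lemma zero_pair_mat: "0\<^sub>m d d = pair_mat d (\<lambda>_. 0) (\<lambda>_. 0)"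
  by (intro eq_matI) (auto simp: pair_mat_def)

lemma pair_mat_mult:
  "pair_mat d f g * pair_mat d f' g' =
   pair_mat d (\<lambda>j. f j * f' j + g (d - 1 - j) * g' j) (\<lambda>j. f (d - 1 - j) * g' j + g j * f' j)"
proof (rule eq_matI, goal_cases)
  case (1 i j)
  then have ij: "i < d" "j < d" by auto
  define A where "A = (\<lambda>i j. (if i = j then f j else 0) + (if i + j + 1 = d then g j else 0))"
  have "(pair_mat d f g * pair_mat d f' g') $$ (i, j) =
      (\<Sum>k<d. A i k * ((if k = j then f' j else 0) + (if k = d - 1 - j then g' j else 0)))"
    using ij by (auto simp: pair_mat_def scalar_prod_def A_def lessThan_atLeast0 intro!: sum.cong)
  also have "\<dots> = A i j * f' j + A i (d - 1 - j) * g' j"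
    using ij by (simp add: distrib_left sum.distrib if_distrib[of "\<lambda>x. _ * x"] cong: if_cong)
  also have "\<dots> = (if i = j then f j * f' j + g (d - 1 - j) * g' j else 0) +
      (if i + j + 1 = d then f (d - 1 - j) * g' j + g j * f' j else 0)"
    using ij by (auto simp: A_def algebra_simps)
  finally show ?case using ij by (simp add: pair_mat_def)
qed auto

lemma det_pair_mat_diag: "det (pair_mat d f (\<lambda>_. 0)) = (\<Prod>k<d. f k)"
proof -
  have "det (pair_mat d f (\<lambda>_. 0)) = prod_list (diag_mat (pair_mat d f (\<lambda>_. 0)))"
    by (rule det_upper_triangular[of _ d]) (auto simp: pair_mat_def)
  also have "diag_mat (pair_mat d f (\<lambda>_. 0)) = map f [0..<d]"
    by (auto simp: diag_mat_def pair_mat_def)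
  finally show ?thesis
    using prod.distinct_set_conv_list[of "[0..<d]" f] by (simp add: lessThan_atLeast0)
qed

lemma pair_mat_split:
  "pair_mat (N + N) f g =
    four_block_mat (pair_mat N f (\<lambda>_. 0)) (pair_mat N (\<lambda>_. 0) (\<lambda>j. g (N + j)))
                   (pair_mat N (\<lambda>_. 0) g) (pair_mat N (\<lambda>j. f (N + j)) (\<lambda>_. 0))"
  by (intro eq_matI) (auto simp: pair_mat_def four_block_mat_def)

text \<open>Reversing the order of the second half of the basis turns the four blocks into diagonal,
  hence commuting, matrices.\<close>

lemma det_pair_mat:
  "det (pair_mat (2 * N) f g) =
    (\<Prod>k<N. f k * f (2 * N - 1 - k) - g k * g (2 * N - 1 - k))"
proof -
  let ?Z = "\<lambda>_. 0 :: complex"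
  let ?J = "pair_mat N ?Z (\<lambda>_. 1)"
  define E where "E = four_block_mat (1\<^sub>m N) (0\<^sub>m N N) (0\<^sub>m N N) ?J"
  define K where "K = four_block_mat (pair_mat N f ?Z) (pair_mat N (\<lambda>j. g (2 * N - 1 - j)) ?Z)
    (pair_mat N g ?Z) (pair_mat N (\<lambda>j. f (2 * N - 1 - j)) ?Z)"
  have c: "E \<in> carrier_mat (N + N) (N + N)" "K \<in> carrier_mat (N + N) (N + N)"
    by (auto simp: E_def K_def)
  have EE: "E * E = 1\<^sub>m (N + N)"
    unfolding E_def one_pair_mat zero_pair_mat pair_mat_split
    by (subst mult_four_block_mat[of _ N N _ N _ N _ _ N _ N])
       (simp_all add: pair_mat_mult pair_mat_add)
  \<comment> \<open>The sign of \<open>det E\<close> can stay open, because \<open>E\<close> enters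
    twice in the factorisation below.\<close>
  then have "det E * det E = 1"
    by (metis c(1) det_mult det_one)
  have "pair_mat (N + N) f g = E * K * E"
    unfolding E_def K_def pair_mat_split one_pair_mat zero_pair_mat
    by (subst mult_four_block_mat[of _ N N _ N _ N _ _ N _ N];
        (subst mult_four_block_mat[of _ N N _ N _ N _ _ N _ N])?)
       (auto simp: pair_mat_mult pair_mat_add intro!: arg_cong4[of _ _ _ _ _ _ _ _ four_block_mat] pair_mat_cong)
  then have "det (pair_mat (N + N) f g) = det E * det K * det E"
    using det_mult[OF mult_carrier_mat[OF c] c(1)] det_mult[OF c] by simp
  also have "\<dots> = det K" using \<open>det E * det E = 1\<close> by (simp add: mult_ac)
  also have "\<dots> = det (pair_mat N f ?Z * pair_mat N (\<lambda>j. f (2 * N - 1 - j)) ?Z -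
      pair_mat N (\<lambda>j. g (2 * N - 1 - j)) ?Z * pair_mat N g ?Z)"
    unfolding K_def
    by (rule det_four_block_mat) (auto simp: pair_mat_mult mult.commute)
  also have "\<dots> = (\<Prod>k<N. f k * f (2 * N - 1 - k) - g k * g (2 * N - 1 - k))"
    by (simp add: pair_mat_mult pair_mat_minus det_pair_mat_diag mult.commute)
  finally show ?thesis by (simp add: mult_2)
qed

text \<open>Here \<open>C + D * G\<close> is the Schur complement of the block \<open>B\<close>, with the hypothesis on \<open>G\<close>
  replacing the inverse of \<open>B\<close>.\<close>

lemma det_four_block_mat_schur:
  fixes A B C D :: "'a :: idom mat"
  assumes "A \<in> carrier_mat d d" "B \<in> carrier_mat d d" "C \<in> carrier_mat d d" "D \<in> carrier_mat d d"
    and G: "G \<in> carrier_mat d d" "B * G = - A" and "even d"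
  shows "det (four_block_mat A B C D) = det B * det (C + D * G)"
proof -
  \<comment> \<open>Right multiplication by \<open>W\<close> swaps the block columns and then adds
    the new first one times \<open>G\<close> to the second, so that \<open>A\<close> becomes
    \<open>A + B * G = 0\<close>. Its determinant is \<open>(-1)^d\<close>.\<close>
  define W :: "'a mat" where "W = four_block_mat (0\<^sub>m d d) (1\<^sub>m d) (1\<^sub>m d) G"
  have "det W = det (0\<^sub>m d d * G - 1\<^sub>m d * 1\<^sub>m d)"
    unfolding W_def using G by (intro det_four_block_mat) auto
  also have "0\<^sub>m d d * G - 1\<^sub>m d * 1\<^sub>m d = (-1) \<cdot>\<^sub>m (1\<^sub>m d :: 'a mat)"
    using G by (intro eq_matI) auto
  also have "det \<dots> = 1" using \<open>even d\<close> by (simp add: det_smult)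
  finally have W: "det W = 1" .
  have "four_block_mat A B C D * W = four_block_mat B (0\<^sub>m d d) D (C + D * G)"
    unfolding W_def using assms
    by (subst mult_four_block_mat[of _ d d _ d _ d _ _ d _ d]) auto
  moreover have "det (four_block_mat A B C D * W) = det (four_block_mat A B C D) * det W"
    by (rule det_mult[of _ "d + d"]) (use assms in \<open>auto simp: W_def\<close>)
  ultimately show ?thesis
    using W assms by (simp add: det_four_block_mat_upper_right_zero[of _ d _ d])
qed

section \<open>Evaluating Fox derivatives\<close>

lemma lin_ext_carrier [simp]: "lin_ext d \<phi> p \<in> carrier_mat d d"
  by (simp add: lin_ext_def)

lemma lin_ext_dim [simp]: "dim_row (lin_ext d \<phi> p) = d" "dim_col (lin_ext d \<phi> p) = d"
  by (simp_all add: lin_ext_def)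

text \<open>Coefficients vanish off the support, so elements with different supports can be summed
  over one common finite set.\<close>

lemma lin_ext_index:
  assumes "finite S" "Poly_Mapping.keys p \<subseteq> S" "i < d" "j < d"
  shows "lin_ext d \<phi> p $$ (i, j) = (\<Sum>a\<in>S. of_int (Poly_Mapping.lookup p a) * \<phi> a $$ (i, j))"
  using assms
  by (auto simp: lin_ext_def in_keys_iff intro!: sum.mono_neutral_left)

lemma lin_ext_zero: "lin_ext d \<phi> 0 = 0\<^sub>m d d"
  by (intro eq_matI) (auto simp: lin_ext_def)

lemma lin_ext_add: "lin_ext d \<phi> (p + q) = lin_ext d \<phi> p + lin_ext d \<phi> q"
proof (intro eq_matI)
  fix i j
  assume "i < dim_row (lin_ext d \<phi> p + lin_ext d \<phi> q)" "j < dim_col (lin_ext d \<phi> p + lin_ext d \<phi> q)"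
  then have ij: "i < d" "j < d" by (auto simp: lin_ext_def)
  let ?S = "Poly_Mapping.keys p \<union> Poly_Mapping.keys q"
  have "lin_ext d \<phi> r $$ (i, j) = (\<Sum>a\<in>?S. of_int (Poly_Mapping.lookup r a) * \<phi> a $$ (i, j))"
    if "Poly_Mapping.keys r \<subseteq> ?S" for r
    using that ij by (intro lin_ext_index) auto
  from this[of p] this[of q] this[of "p + q"]
  show "lin_ext d \<phi> (p + q) $$ (i, j) = (lin_ext d \<phi> p + lin_ext d \<phi> q) $$ (i, j)"
    using ij keys_add[of p q]
    by (simp add: lin_ext_def lookup_add distrib_right sum.distrib)
qed (auto simp: lin_ext_def)

lemma lin_ext_uminus: "lin_ext d \<phi> (- p) = - lin_ext d \<phi> p"
  by (intro eq_matI) (auto simp: lin_ext_def sum_negf)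

lemma lin_ext_diff: "lin_ext d \<phi> (p - q) = lin_ext d \<phi> p - lin_ext d \<phi> q"
proof -
  have "lin_ext d \<phi> (p - q) = lin_ext d \<phi> p + - lin_ext d \<phi> q"
    by (metis lin_ext_add lin_ext_uminus diff_conv_add_uminus)
  then show ?thesis by (metis minus_add_uminus_mat lin_ext_carrier)
qed

lemma lin_ext_single:
  assumes "\<phi> a \<in> carrier_mat d d"
  shows "lin_ext d \<phi> (Poly_Mapping.single a 1) = \<phi> a"
  using assms by (intro eq_matI) (auto simp: lin_ext_def)

lemma lin_ext_sum_index:
  assumes "finite S" "i < d" "j < d"
  shows "lin_ext d \<phi> (\<Sum>x\<in>S. p x) $$ (i, j) = (\<Sum>x\<in>S. lin_ext d \<phi> (p x) $$ (i, j))"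
  using assms(1)
proof (induction S)
  case (insert x S)
  then show ?case
    using assms by (simp add: lin_ext_add)
qed (use assms in \<open>simp add: lin_ext_zero\<close>)

text \<open>The product rule in \<open>fox\<close> only multiplies by a single group element from
  the left, so multiplicativity of \<phi> is asked only for \<open>a\<close> against the support of
  \<open>p\<close>.\<close>

lemma lin_ext_ring_mult_single:
  assumes "\<phi> a \<in> carrier_mat d d"
    and "\<And>b. b \<in> Poly_Mapping.keys p \<Longrightarrow> \<phi> b \<in> carrier_mat d d"
    and "\<And>b. b \<in> Poly_Mapping.keys p \<Longrightarrow> \<phi> (a \<otimes>\<^bsub>G\<^esub> b) = \<phi> a * \<phi> b"
  shows "lin_ext d \<phi> (ring_mult G (Poly_Mapping.single a 1) p) = \<phi> a * lin_ext d \<phi> p"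
proof (intro eq_matI)
  fix i j
  assume "i < dim_row (\<phi> a * lin_ext d \<phi> p)" "j < dim_col (\<phi> a * lin_ext d \<phi> p)"
  then have ij: "i < d" "j < d" using assms(1) by (auto simp: lin_ext_def)
  have s: "lin_ext d \<phi> (Poly_Mapping.single c k) $$ (i, j) = of_int k * \<phi> c $$ (i, j)" for c k
    using ij by (auto simp: lin_ext_def)
  have "lin_ext d \<phi> (ring_mult G (Poly_Mapping.single a 1) p) $$ (i, j) =
      (\<Sum>b\<in>Poly_Mapping.keys p. of_int (Poly_Mapping.lookup p b) * (\<phi> a * \<phi> b) $$ (i, j))"
    using ij assms(3) by (simp add: ring_mult_def lin_ext_sum_index s)
  also have "\<dots> = (\<Sum>b\<in>Poly_Mapping.keys p. \<Sum>k<d.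
      of_int (Poly_Mapping.lookup p b) * (\<phi> a $$ (i, k) * \<phi> b $$ (k, j)))"
  proof (rule sum.cong[OF refl])
    fix b assume "b \<in> Poly_Mapping.keys p"
    then have "\<phi> b \<in> carrier_mat d d" by (rule assms(2))
    then show "of_int (Poly_Mapping.lookup p b) * (\<phi> a * \<phi> b) $$ (i, j) =
        (\<Sum>k<d. of_int (Poly_Mapping.lookup p b) * (\<phi> a $$ (i, k) * \<phi> b $$ (k, j)))"
      using ij assms(1) by (auto simp: scalar_prod_def sum_distrib_left lessThan_atLeast0)
  qed
  also have "\<dots> = (\<phi> a * lin_ext d \<phi> p) $$ (i, j)"
    using ij assms(1)
    by (subst sum.swap) (simp add: scalar_prod_def lin_ext_def sum_distrib_left lessThan_atLeast0 mult_ac)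
  finally show "lin_ext d \<phi> (ring_mult G (Poly_Mapping.single a 1) p) $$ (i, j) =
    (\<phi> a * lin_ext d \<phi> p) $$ (i, j)" .
qed (use assms(1) in \<open>auto simp: lin_ext_def\<close>)

text \<open>The type of the group ring also has basis elements that are not classes of words, where
  nothing is known about a representation; Fox derivatives avoid them.\<close>

lemma keys_fox: "Poly_Mapping.keys (fox g w) \<subseteq> range word_class"
proof (induction w)
  case (Cons l w)
  have "Poly_Mapping.keys (fox_letter g l) \<subseteq> range word_class"
    by (cases l) auto
  moreover have "Poly_Mapping.keys (ring_mult free_group (ring_word [l]) (fox g w)) \<subseteq> range word_class"
  proof -
    have "Poly_Mapping.keys (Poly_Mapping.single (word_class [l] \<otimes>\<^bsub>free_group\<^esub> b) c) \<subseteq> range word_class"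
      if "b \<in> Poly_Mapping.keys (fox g w)" for b and c :: int
    proof -
      from that Cons.IH obtain v where "b = word_class v" by blast
      then show ?thesis by (simp add: free_mult)
    qed
    then show ?thesis
      unfolding ring_mult_def
      by (simp, intro order.trans[OF keys_sum] UN_least) simp
  qed
  ultimately show ?case using keys_add by fastforce
qed simp

context
  fixes d :: nat and \<phi> :: "'g word set \<Rightarrow> complex mat" and R :: "'g word \<Rightarrow> complex mat"
  assumes \<phi>: "\<And>w. \<phi> (word_class w) = R w"
    and R_carrier: "\<And>w. R w \<in> carrier_mat d d"
    and R_append: "\<And>u v. R (u @ v) = R u * R v"
begin

lemma lin_ext_fox_Cons:
  "lin_ext d \<phi> (fox g (l # w)) = lin_ext d \<phi> (fox_letter g l) + R [l] * lin_ext d \<phi> (fox g w)"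
proof -
  have "lin_ext d \<phi> (ring_mult free_group (ring_word [l]) (fox g w)) =
      \<phi> (word_class [l]) * lin_ext d \<phi> (fox g w)"
  proof (rule lin_ext_ring_mult_single)
    fix b assume "b \<in> Poly_Mapping.keys (fox g w)"
    then obtain v where "b = word_class v" using keys_fox[of g w] by (auto dest: subsetD)
    then show "\<phi> b \<in> carrier_mat d d"
      "\<phi> (word_class [l] \<otimes>\<^bsub>free_group\<^esub> b) = \<phi> (word_class [l]) * \<phi> b"
      by (simp_all add: \<phi> free_mult R_carrier R_append[of "[l]" v, simplified])
  qed (simp add: \<phi> R_carrier)
  then show ?thesis by (simp add: lin_ext_add \<phi>)
qed

text \<open>With this general product rule a relator can be cut into powers of letters. By
  \<open>R_append\<close> alone \<open>R []\<close> would only be an idempotent, hence the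
  assumption on it.\<close>

lemma lin_ext_fox_append:
  assumes "R [] = 1\<^sub>m d"
  shows "lin_ext d \<phi> (fox g (u @ v)) = lin_ext d \<phi> (fox g u) + R u * lin_ext d \<phi> (fox g v)"
proof (induction u)
  case Nil
  then show ?case by (simp add: assms lin_ext_zero left_mult_one_mat[of _ d d] left_add_zero_mat[of _ d d])
next
  case (Cons l u)
  let ?L = "\<lambda>w. lin_ext d \<phi> (fox g w)"
  have "?L ((l # u) @ v) = lin_ext d \<phi> (fox_letter g l) + R [l] * (?L u + R u * ?L v)"
    by (simp only: append_Cons lin_ext_fox_Cons Cons.IH)
  also have "R [l] * (?L u + R u * ?L v) = R [l] * ?L u + R [l] * (R u * ?L v)"
    by (rule mult_add_distrib_mat[OF R_carrier lin_ext_carrier mult_carrier_mat[OF R_carrier lin_ext_carrier]])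
  also have "R [l] * (R u * ?L v) = R (l # u) * ?L v"
    by (simp add: R_append[of "[l]" u, simplified] assoc_mult_mat[OF R_carrier R_carrier lin_ext_carrier])
  also have "lin_ext d \<phi> (fox_letter g l) + (R [l] * ?L u + R (l # u) * ?L v) =
      ?L (l # u) + R (l # u) * ?L v"
    unfolding lin_ext_fox_Cons
    by (rule assoc_add_mat[symmetric, OF lin_ext_carrier mult_carrier_mat[OF R_carrier lin_ext_carrier]
          mult_carrier_mat[OF R_carrier lin_ext_carrier]])
  finally show ?case .
qed

lemma lin_ext_fox_letter:
  assumes "R [] = 1\<^sub>m d"
  shows "lin_ext d \<phi> (fox_letter g l) =
    (if l = Pos g then 1\<^sub>m d else if l = Neg g then - R [l] else 0\<^sub>m d d)"
  using assms R_carrier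
  by (cases l) (auto simp: lin_ext_single lin_ext_uminus lin_ext_zero \<phi>)

end

section \<open>The symmetric powers of the representation\<close>

lemma bi_monomial: "bi_x ^ a * bi_y ^ b = monom (monom 1 a) b"
proof -
  have "bi_x ^ a = [:monom 1 a:]"
    by (induction a) (auto simp: bi_x_def monom_Suc one_pCons)
  moreover have "bi_y ^ b = monom 1 b"
    by (induction b) (auto simp: bi_y_def monom_Suc monom_0 simp flip: one_pCons)
  ultimately show ?thesis by (simp add: smult_monom)
qed

lemma bi_const_zero [simp]: "bi_const 0 = 0"
  by (simp add: bi_const_def)

lemma bi_const_mult: "bi_const (a * b) = bi_const a * bi_const b"
  by (simp add: bi_const_def)

lemma bi_const_power: "bi_const (a ^ k) = bi_const a ^ k"
  by (induction k) (auto simp: bi_const_mult, simp add: bi_const_def one_pCons)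

lemma coeff_bi_monomial:
  "coeff (coeff (bi_const c * (bi_x ^ a * bi_y ^ b)) j) i = (if i = a \<and> j = b then c else 0)"
  by (auto simp: bi_monomial bi_const_def coeff_monom)

text \<open>The action substitutes by the inverse matrix, so \<open>x\<close> becomes
  \<open>x/a\<close> and \<open>y\<close> becomes \<open>a y\<close>. The \<open>k\<close>-th
  eigenvalue is thus \<open>a^(2k - (d - 1))\<close>, an odd power of \<open>a\<close> for even
  \<open>d\<close>.\<close>

lemma sigma_diag2:
  assumes "a \<noteq> 0"
  shows "sigma d (diag2 a) = pair_mat d (\<lambda>k. inverse a ^ (d - 1 - k) * a ^ k) (\<lambda>_. 0)"
proof -
  have "sl2_act (diag2 a) (bi_x ^ i * bi_y ^ k) =
      bi_const (inverse a ^ i * a ^ k) * (bi_x ^ i * bi_y ^ k)" for i k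
    using assms
    by (simp add: sl2_act_def diag_anti_inv bi_subst_monomial)
       (simp add: diag2_def power_mult_distrib bi_const_mult bi_const_power mult_ac)
  then show ?thesis
    by (intro eq_matI) (auto simp: sigma_def pair_mat_def coeff_bi_monomial)
qed

text \<open>Here \<open>x\<close> becomes \<open>- a y\<close> and \<open>y\<close> becomes
  \<open>x/a\<close>, which exchanges the two exponents of a monomial.\<close>

lemma sigma_anti2:
  assumes "a \<noteq> 0"
  shows "sigma d (anti2 a) = pair_mat d (\<lambda>_. 0) (\<lambda>k. (- a) ^ (d - 1 - k) * inverse a ^ k)"
proof -
  have "sl2_act (anti2 a) (bi_x ^ i * bi_y ^ k) =
      bi_const ((- a) ^ i * inverse a ^ k) * (bi_x ^ k * bi_y ^ i)" for i k
    using assms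
    by (simp add: sl2_act_def diag_anti_inv bi_subst_monomial)
       (simp add: anti2_def power_mult_distrib bi_const_mult bi_const_power mult_ac)
  then show ?thesis
    by (intro eq_matI) (auto simp: sigma_def pair_mat_def coeff_bi_monomial)
qed

text \<open>Multiplicativity is checked on diagonal and antidiagonal matrices; by
  \<open>monomial_word\<close> every word in the generators evaluates to one of these.\<close>

lemma sigma_mult_monomial:
  assumes "a \<noteq> 0" "b \<noteq> 0" "A = diag2 a \<or> A = anti2 a" "B = diag2 b \<or> B = anti2 b"
  shows "sigma d (A * B) = sigma d A * sigma d B"
  using assms(3,4)
proof (elim disjE)
  assume "A = diag2 a" "B = diag2 b"
  with assms(1,2) show ?thesis
    by (auto simp: diag_anti_mult sigma_diag2 sigma_anti2 pair_mat_mult power_mult_distrib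
        intro!: pair_mat_cong)
next
  assume "A = diag2 a" "B = anti2 b"
  with assms(1,2) show ?thesis
    by (auto simp: diag_anti_mult sigma_diag2 sigma_anti2 pair_mat_mult power_mult_distrib
        power_minus[of a] power_minus[of b] power_minus[of "a * b"] intro!: pair_mat_cong)
next
  assume "A = anti2 a" "B = diag2 b"
  with assms(1,2) show ?thesis
    by (auto simp: diag_anti_mult sigma_diag2 sigma_anti2 pair_mat_mult power_mult_distrib
        power_minus[of a] power_minus[of "a * inverse b"] intro!: pair_mat_cong)
next
  assume "A = anti2 a" "B = anti2 b"
  with assms(1,2) show ?thesis
    by (auto simp: diag_anti_mult sigma_diag2 sigma_anti2 pair_mat_mult power_mult_distrib
        power_minus[of a] power_minus[of b] power_minus[of "a * inverse b"] power_minus[of "inverse a * b"]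
        power_minus[of "a / b"] power_minus[of "b / a"] divide_inverse
        intro!: pair_mat_cong)
qed

text \<open>This moves all computations to words, where only the three prescribed matrices
  enter.\<close>

lemma hom_knot_group_word_eval:
  assumes "\<rho> \<in> hom (knot_group m n) H" "group H"
  shows "\<rho> (knot_proj m n (word_class w)) = word_eval H (\<lambda>g. \<rho> (knot_gen m n g)) w"
proof -
  interpret \<rho>: group_hom "knot_group m n" H \<rho>
    by (intro group_hom.intro group_knot_group assms group_hom_axioms.intro)
  interpret F: group "free_group :: gen word set monoid" by (rule group_free_group)
  interpret P: group_hom free_group "knot_group m n" "knot_proj m n"
    using pres_proj_hom[of "knot_relators m n"]
    by (intro group_hom.intro group_free_group group_knot_group group_hom_axioms.intro)
       (simp add: knot_proj_def[abs_def] knot_group_def)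
  have wc: "word_class v \<in> carrier free_group" for v :: "gen word"
    by (simp add: free_carrier)
  show ?thesis
  proof (induction w)
    case Nil
    show ?case using P.hom_one \<rho>.hom_one by (simp add: free_one)
  next
    case (Cons l w)
    have "word_class (l # w) = word_class [l] \<otimes>\<^bsub>free_group\<^esub> word_class w"
      by (simp add: free_mult)
    then have "\<rho> (knot_proj m n (word_class (l # w))) =
        \<rho> (knot_proj m n (word_class [l])) \<otimes>\<^bsub>H\<^esub> \<rho> (knot_proj m n (word_class w))"
      using wc by simp
    moreover have "\<rho> (knot_proj m n (word_class [l])) =
        (case l of Pos g \<Rightarrow> \<rho> (knot_gen m n g) | Neg g \<Rightarrow> inv\<^bsub>H\<^esub> \<rho> (knot_gen m n g))"
    proof (cases l)
      case (Neg g)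
      have "word_class [Neg g] = inv\<^bsub>free_group\<^esub> word_class [Pos g]"
        using word_class_inverse[of "[Pos g]"]
        by (intro F.inv_equality[symmetric] wc) (simp add: free_mult free_one)
      then show ?thesis using wc by (simp add: Neg knot_gen_def)
    qed (simp add: knot_gen_def)
    ultimately show ?case by (simp add: Cons.IH)
  qed
qed

section \<open>Fox derivatives of powers of a generator and of the two relators\<close>

text \<open>The factor \<open>t^k\<close> turns the exponent \<open>-(i + 1)\<close> into
  \<open>k - 1 - i\<close>, which reverses the sum. This rewrites the contribution of the negative
  powers that end each relator.\<close>

lemma power_times_sum_inverse_powers:
  fixes t :: "'a :: field"
  assumes "t \<noteq> 0"
  shows "t ^ k * (\<Sum>i<k. inverse t ^ Suc i) = (\<Sum>i<k. t ^ i)"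
proof -
  have "t ^ k * inverse t ^ Suc (k - Suc i) = t ^ i" if "i < k" for i
  proof -
    have "t ^ k = t ^ i * t ^ Suc (k - Suc i)"
      using that by (metis Suc_diff_Suc add_diff_inverse_nat less_imp_le_nat not_less power_add)
    moreover have "t ^ Suc (k - Suc i) * inverse t ^ Suc (k - Suc i) = 1"
      using assms by (simp flip: power_mult_distrib del: power_Suc)
    ultimately show ?thesis by (simp add: mult.assoc del: power_Suc)
  qed
  then show ?thesis
    by (subst sum.nat_diff_reindex[symmetric]) (simp add: sum_distrib_left del: power_Suc)
qed

context
  fixes d :: nat and \<phi> :: "'g word set \<Rightarrow> complex mat" and R :: "'g word \<Rightarrow> complex mat"
  assumes \<phi>: "\<And>w. \<phi> (word_class w) = R w"
    and R_carrier: "\<And>w. R w \<in> carrier_mat d d"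
    and R_append: "\<And>u v. R (u @ v) = R u * R v"
    and R_Nil: "R [] = 1\<^sub>m d"
begin

lemma lin_ext_fox_Pos:
  assumes "R [Pos g] = pair_mat d f f'"
  shows "lin_ext d \<phi> (fox h [Pos g]) = pair_mat d (\<lambda>_. if h = g then 1 else 0) (\<lambda>_. 0)"
  unfolding lin_ext_fox_Cons[OF \<phi> R_carrier R_append] lin_ext_fox_letter[OF \<phi> R_carrier R_append R_Nil] assms
  by (simp add: lin_ext_zero zero_pair_mat one_pair_mat pair_mat_mult pair_mat_add)

lemma lin_ext_fox_Neg:
  assumes "R [Neg g] = pair_mat d f f'"
  shows "lin_ext d \<phi> (fox h [Neg g]) =
    pair_mat d (\<lambda>j. if h = g then - f j else 0) (\<lambda>j. if h = g then - f' j else 0)"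
  unfolding lin_ext_fox_Cons[OF \<phi> R_carrier R_append] lin_ext_fox_letter[OF \<phi> R_carrier R_append R_Nil] assms
  by (simp add: lin_ext_zero zero_pair_mat one_pair_mat pair_mat_mult pair_mat_add pair_mat_uminus)

lemma word_image_replicate:
  assumes "R [l] = pair_mat d f (\<lambda>_. 0)"
  shows "R (replicate k l) = pair_mat d (\<lambda>j. f j ^ k) (\<lambda>_. 0)"
proof (induction k)
  case (Suc k)
  have "R (replicate (Suc k) l) = R [l] * R (replicate k l)"
    using R_append[of "[l]" "replicate k l"] by simp
  then show ?case by (simp add: assms Suc.IH pair_mat_mult)
qed (simp add: R_Nil one_pair_mat)

lemma lin_ext_fox_replicate_Pos:
  assumes "R [Pos g] = pair_mat d f (\<lambda>_. 0)"
  shows "lin_ext d \<phi> (fox h (replicate k (Pos g))) =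
    pair_mat d (\<lambda>j. if h = g then \<Sum>i<k. f j ^ i else 0) (\<lambda>_. 0)"
proof (induction k)
  case (Suc k)
  show ?case
    unfolding replicate_Suc lin_ext_fox_Cons[OF \<phi> R_carrier R_append] Suc.IH assms
      lin_ext_fox_letter[OF \<phi> R_carrier R_append R_Nil] zero_pair_mat one_pair_mat
    by (auto simp: pair_mat_mult pair_mat_add sum.lessThan_Suc_shift sum_distrib_left simp del: sum.lessThan_Suc)
qed (simp add: lin_ext_zero zero_pair_mat cong: if_cong)

text \<open>Here \<open>f\<close> belongs to the inverse letter. The exponents start at 1 because
  the derivative of \<open>x^-1\<close> is \<open>- x^-1\<close>.\<close>

lemma lin_ext_fox_replicate_Neg:
  assumes "R [Neg g] = pair_mat d f (\<lambda>_. 0)"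
  shows "lin_ext d \<phi> (fox h (replicate k (Neg g))) =
    pair_mat d (\<lambda>j. if h = g then - (\<Sum>i<k. f j ^ Suc i) else 0) (\<lambda>_. 0)"
proof (induction k)
  case (Suc k)
  show ?case
    unfolding replicate_Suc lin_ext_fox_Cons[OF \<phi> R_carrier R_append] Suc.IH assms
      lin_ext_fox_letter[OF \<phi> R_carrier R_append R_Nil] zero_pair_mat one_pair_mat
    by (auto simp: pair_mat_mult pair_mat_add pair_mat_uminus sum.lessThan_Suc_shift sum_distrib_left simp del: sum.lessThan_Suc)
qed (simp add: lin_ext_zero zero_pair_mat cong: if_cong)

end

text \<open>Conjugation by \<mu> inverts eigenvalues. Hence the part of the relator before the final
  negative powers has the value \<open>t^-m * t^(2m) = t^m\<close> in the first relator and
  \<open>t^-(2mn + 1) = t^(2mn)\<close> in the second, and it turns the sum of negative powers into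
  one of nonnegative powers. The condition on \<open>s\<close> says that \<mu> squares to
  -1.\<close>

lemma fox_relators:
  fixes \<phi> :: "gen word set \<Rightarrow> complex mat" and t s :: "nat \<Rightarrow> complex"
  assumes \<phi>: "\<And>w. \<phi> (word_class w) = R w"
    and R_carrier: "\<And>w. R w \<in> carrier_mat d d"
    and R_append: "\<And>u v. R (u @ v) = R u * R v"
    and R_Nil: "R [] = 1\<^sub>m d"
    and X1: "R [Pos X1] = pair_mat d t (\<lambda>_. 0)" "R [Neg X1] = pair_mat d (\<lambda>j. inverse (t j)) (\<lambda>_. 0)"
    and X2: "R [Pos X2] = pair_mat d (\<lambda>j. t j ^ (2 * m)) (\<lambda>_. 0)"
      "R [Neg X2] = pair_mat d (\<lambda>j. inverse (t j ^ (2 * m))) (\<lambda>_. 0)"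
    and Mu: "R [Pos Mu] = pair_mat d (\<lambda>_. 0) s" "R [Neg Mu] = pair_mat d (\<lambda>_. 0) (\<lambda>j. - s j)"
    and t: "\<And>j. j < d \<Longrightarrow> t (d - 1 - j) = inverse (t j)" "\<And>j. j < d \<Longrightarrow> t j ^ (4 * m * n + 1) = 1"
    and s: "\<And>j. j < d \<Longrightarrow> s (d - 1 - j) * s j = -1"
  shows "lin_ext d \<phi> (fox X1 (relator1 m)) =
      pair_mat d (\<lambda>j. - (\<Sum>i<m. t j ^ i)) (\<lambda>j. s j * (\<Sum>i<m. t j ^ i))" (is ?A)
    and "lin_ext d \<phi> (fox X2 (relator1 m)) = pair_mat d (\<lambda>j. inverse (t j ^ m)) (\<lambda>_. 0)" (is ?B)
    and "lin_ext d \<phi> (fox X1 (relator2 n)) = pair_mat d (\<lambda>_. 0) (\<lambda>j. s j * t j ^ (2 * m * n))" (is ?C)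
    and "lin_ext d \<phi> (fox X2 (relator2 n)) =
      pair_mat d (\<lambda>j. - (\<Sum>i<n. (t j ^ (2 * m)) ^ i)) (\<lambda>j. s j * (\<Sum>i<n. (t j ^ (2 * m)) ^ i))" (is ?D)
proof -
  have t0: "t j \<noteq> 0" if "j < d" for j
    using t(2)[OF that] by auto
  have d: "d - Suc (d - Suc j) = j" if "j < d" for j
    using that by auto
  note facts = \<phi> R_carrier R_append R_Nil
  note L = lin_ext_fox_append[OF \<phi> R_carrier R_append R_Nil]
    lin_ext_fox_Pos[OF facts] lin_ext_fox_Neg[OF facts]
    lin_ext_fox_replicate_Pos[OF facts] lin_ext_fox_replicate_Neg[OF facts]
  note LX = L(2)[OF X1(1)] L(2)[OF X2(1)] L(2)[OF Mu(1)] L(3)[OF X1(2)] L(3)[OF X2(2)] L(3)[OF Mu(2)]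
    L(4)[OF X1(1)] L(4)[OF X2(1)] L(5)[OF X1(2)] L(5)[OF X2(2)]
  note RX = X1 X2 Mu word_image_replicate[OF facts X1(1)] word_image_replicate[OF facts X2(1)]
    word_image_replicate[OF facts X1(2)] word_image_replicate[OF facts X2(2)]
  have r1: "relator1 m = [Pos Mu] @ replicate m (Pos X1) @ [Neg Mu] @ [Pos X2] @ replicate m (Neg X1)"
    by (simp add: relator1_def)
  have r2: "relator2 n = [Pos Mu] @ replicate n (Pos X2) @ [Pos X1] @ [Neg Mu] @ replicate n (Neg X2)"
    by (simp add: relator2_def)
  have ts: "t (d - Suc j) = inverse (t j)" "s (d - Suc j) * s j = -1" "s j * s (d - Suc j) = -1"
    if "j < d" for j
    using t(1)[OF that] s[OF that] by (simp_all add: mult.commute)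
  \<comment> \<open>Each \<mu> is followed later by its inverse; these rules cancel the two factors
    \<open>s\<close> in the various positions that they take in right-nested products.\<close>
  have ss: "s (d - Suc j) * (s j * x) = - x" "s j * (s (d - Suc j) * x) = - x" if "j < d" for j x
    using ts(2,3)[OF that] unfolding mult.assoc[symmetric] by simp_all
  have ss': "s (d - Suc j) * (x * (s j * y)) = - (x * y)"
    "s (d - Suc j) * (x * (y * (s j * w))) = - (x * (y * w))"
    "s (d - Suc j) * (x * s j) = - x" if "j < d" for j x y w
    using ss(1)[OF that, of "x * y"] ss(1)[OF that, of "x * (y * w)"] ss(1)[OF that, of x] by (simp_all add: mult_ac)
  have e1: "inverse (t j) ^ m * (t j ^ (2 * m) * (\<Sum>i<m. inverse (t j) * inverse (t j) ^ i)) = (\<Sum>i<m. t j ^ i)"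
    if "j < d" for j
  proof -
    have "inverse (t j) ^ m * t j ^ (2 * m) = t j ^ m"
      using t0[OF that] by (simp add: mult_2 power_add power_inverse)
    then show ?thesis
      using power_times_sum_inverse_powers[OF t0[OF that], of m] by (simp flip: mult.assoc)
  qed
  have e2: "(inverse (t j) ^ (2 * m)) ^ n * (inverse (t j) * (\<Sum>i<n. inverse (t j ^ (2 * m)) * inverse (t j ^ (2 * m)) ^ i)) =
      (\<Sum>i<n. (t j ^ (2 * m)) ^ i)" if "j < d" for j
  proof -
    \<comment> \<open>This split of the order of \<open>t\<close> identifies
      \<open>t^-(2mn + 1)\<close> with \<open>t^(2mn)\<close>.\<close>
    have "4 * m * n + 1 = 2 * m * n + (2 * m * n + 1)" by simp
    then have "t j ^ (2 * m * n) * (t j ^ (2 * m * n) * t j) = 1"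
      using t(2)[OF that] by (metis power_add power_one_right)
    then have "inverse (t j ^ (2 * m)) ^ n * inverse (t j) = (t j ^ (2 * m)) ^ n"
      using t0[OF that] by (simp add: field_simps flip: power_mult)
    then show ?thesis
      using power_times_sum_inverse_powers[of "t j ^ (2 * m)" n] t0[OF that]
      by (simp add: power_inverse flip: mult.assoc)
  qed
  show ?A
    unfolding r1 r2 L(1) LX RX pair_mat_mult pair_mat_add
    by (rule pair_mat_cong; simp add: ts ss ss' e1 e2 d mult.assoc)
  show ?B
    unfolding r1 r2 L(1) LX RX pair_mat_mult pair_mat_add
    by (rule pair_mat_cong; simp add: ts ss ss' e1 e2 d mult.assoc power_inverse)
  show ?C
    unfolding r1 r2 L(1) LX RX pair_mat_mult pair_mat_add
    by (rule pair_mat_cong; simp add: ts ss ss' e1 e2 d mult.assoc flip: power_mult)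
  show ?D
    unfolding r1 r2 L(1) LX RX pair_mat_mult pair_mat_add
    by (rule pair_mat_cong; simp add: ts ss ss' e1 e2 d mult.assoc)
qed

section \<open>The factor of the torsion at an eigenvalue\<close>

text \<open>The determinant of the Schur complement of the Fox matrix on the plane where \<open>x\<^sub>1\<close> has the
  eigenvalues \<open>t\<close> and \<open>1/t\<close>.\<close>

definition pair_factor :: "nat \<Rightarrow> nat \<Rightarrow> complex \<Rightarrow> complex" where
  "pair_factor m n t =
    (let a = \<Sum>i<m. t ^ i; a' = \<Sum>i<m. inverse t ^ i;
         b = t ^ m * (\<Sum>i<n. (t ^ (2 * m)) ^ i);
         b' = inverse t ^ m * (\<Sum>i<n. (inverse t ^ (2 * m)) ^ i)
     in (t ^ (2 * m * n) + a * (b + b')) * (inverse t ^ (2 * m * n) + a' * (b + b')) - a * a' * (b - b')\<^sup>2)"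

text \<open>Inverting \<open>t\<close> exchanges the primed and unprimed quantities, in which the
  expression is symmetric.\<close>

lemma pair_factor_inverse: "pair_factor m n (inverse t) = pair_factor m n t"
proof -
  have sym: "(g' + a' * (b' + b)) * (g + a * (b' + b)) - a' * a * (b' - b)\<^sup>2 =
      (g + a * (b + b')) * (g' + a' * (b + b')) - a * a' * (b - b')\<^sup>2" for a a' b b' g g' :: complex
    by (simp only: power2_commute[of b' b] add.commute[of b' b] mult.commute[of a' a]
        mult.commute[of "g' + a' * (b + b')"])
  show ?thesis
    unfolding pair_factor_def Let_def inverse_inverse_eq by (rule sym)
qed

lemma pair_factor_one: "pair_factor m n 1 = of_nat ((2 * m * n + 1)\<^sup>2)"
proof -
  have "pair_factor m n 1 = (1 + of_nat m * (of_nat n + of_nat n))\<^sup>2"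
    by (simp add: pair_factor_def Let_def power2_eq_square)
  also have "1 + of_nat m * (of_nat n + of_nat n) = (of_nat (2 * m * n + 1) :: complex)"
    by (simp add: distrib_left)
  finally show ?thesis by simp
qed

lemma cmod_one_minus_inverse:
  assumes "cmod x = 1" shows "cmod (1 - inverse x) = cmod (1 - x)"
proof -
  have "x \<noteq> 0" using assms by auto
  then have "1 - inverse x = - ((1 - x) * inverse x)" by (simp add: field_simps)
  then show ?thesis using assms by (simp add: norm_mult norm_inverse)
qed

text \<open>Closed forms of the geometric sums together with \<open>1/t = g^2\<close> reduce the
  factor to \<open>4 a a' b b'\<close>. The three inequalities keep the denominators and the later
  logarithms away from 0.\<close>

lemma cmod_pair_factor:
  assumes "t ^ (4 * m * n + 1) = 1" "t \<noteq> 1"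
  shows "t ^ m \<noteq> 1" "t ^ (2 * m * n) \<noteq> 1" "t ^ (2 * m) \<noteq> 1"
    and "cmod (pair_factor m n t) =
      4 * (cmod (1 - t ^ m) * cmod (1 - t ^ (2 * m * n)) / (cmod (1 - t) * cmod (1 - t ^ (2 * m))))\<^sup>2"
proof -
  define g g' h h' where gh: "g = t ^ (2 * m * n)" "g' = inverse t ^ (2 * m * n)" "h = t ^ m" "h' = inverse t ^ m"
  define a a' b b' where ab: "a = (\<Sum>i<m. t ^ i)" "a' = (\<Sum>i<m. inverse t ^ i)"
    "b = h * (\<Sum>i<n. (h\<^sup>2) ^ i)" "b' = h' * (\<Sum>i<n. (h'\<^sup>2) ^ i)"
  have t0: "t \<noteq> 0" using assms(1) by auto
  have "cmod t ^ (4 * m * n + 1) = 1" using assms(1) by (simp only: norm_one flip: norm_power)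
  then have nt: "cmod t = 1" using power_eq_imp_eq_base[of "cmod t" "4 * m * n + 1" 1] by simp
  have h2: "h\<^sup>2 = t ^ (2 * m)" "h'\<^sup>2 = inverse t ^ (2 * m)" by (simp_all only: gh power_even_eq)
  have g: "(h\<^sup>2) ^ n = g" "(h'\<^sup>2) ^ n = g'" unfolding h2 unfolding gh by (simp_all only: power_mult)
  have "t * g\<^sup>2 = t ^ Suc (2 * m * n * 2)" by (simp only: gh power_Suc power_mult)
  also have "Suc (2 * m * n * 2) = 4 * m * n + 1" by simp
  finally have tg: "t * g\<^sup>2 = 1" unfolding assms(1) .
  have inv: "g * g' = 1" "h * h' = 1" by (simp_all only: gh power_mult_distrib[symmetric] right_inverse[OF t0] power_one)
  have g2: "g\<^sup>2 \<noteq> 1" using tg assms(2) by auto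
  have "h\<^sup>2 \<noteq> 1"
  proof
    assume "h\<^sup>2 = 1"
    then have "g = 1" using g by simp
    with g2 show False by simp
  qed
  then show "t ^ m \<noteq> 1" "t ^ (2 * m * n) \<noteq> 1" "t ^ (2 * m) \<noteq> 1"
    using g2 unfolding h2(1)[symmetric] gh(1,3)[symmetric] by auto
  have t: "inverse t = g\<^sup>2" "t = g'\<^sup>2"
  proof -
    show "inverse t = g\<^sup>2" using tg t0 by (simp add: field_simps)
    have "t = t * g\<^sup>2 * g'\<^sup>2" by (metis inv(1) power_mult_distrib mult.assoc power_one mult.right_neutral)
    then show "t = g'\<^sup>2" using tg by simp
  qed
  have A: "(1 - t) * a = 1 - h" "(1 - inverse t) * a' = 1 - h'"
    by (simp_all only: ab gh flip: one_diff_power_eq)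
  have B: "(1 - h\<^sup>2) * b = h * (1 - g)" "(1 - h'\<^sup>2) * b' = h' * (1 - g')"
    using one_diff_power_eq[of "h\<^sup>2" n] one_diff_power_eq[of "h'\<^sup>2" n] unfolding g ab
    by (simp_all add: mult.left_commute)
  have cancel: "g * (g' * x) = x" "g' * (g * x) = x" "h * (h' * x) = x" "h' * (h * x) = x" for x
    using inv by (simp_all add: mult.commute flip: mult.assoc)
  \<comment> \<open>From \<open>1 - t = g' (g - g')\<close> and \<open>1 - h^2 = h (h' - h)\<close>,
    and the same for the inverses, a quantity and its primed partner get opposite
    denominators.\<close>
  have 1: "(g - g') * (g' * a) = 1 - h" "(g' - g) * (g * a') = 1 - h'"
  proof -
    have "(1 - g'\<^sup>2) * a = 1 - h" "(1 - g\<^sup>2) * a' = 1 - h'"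
      using A by (simp_all only: t(2)[symmetric] t(1)[symmetric])
    then show "(g - g') * (g' * a) = 1 - h" "(g' - g) * (g * a') = 1 - h'"
      by (simp_all add: left_diff_distrib power2_eq_square mult.assoc cancel)
  qed
  have 2: "(h' - h) * b = 1 - g" "(h - h') * b' = 1 - g'"
  proof -
    have "(h' - h) * b = h' * ((1 - h\<^sup>2) * b)" "(h - h') * b' = h * ((1 - h'\<^sup>2) * b')"
      by (simp_all add: left_diff_distrib right_diff_distrib power2_eq_square mult.assoc cancel)
    then show "(h' - h) * b = 1 - g" "(h - h') * b' = 1 - g'"
      unfolding B cancel by simp_all
  qed
  have ne: "g - g' \<noteq> 0" "h' - h \<noteq> 0"
    using inv g2 \<open>h\<^sup>2 \<noteq> 1\<close> by (auto simp: power2_eq_square)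
  \<comment> \<open>By the formulas above, \<open>g' a + g a' = (h' - h)/(g - g')\<close> and
    \<open>b + b' = (g' - g)/(h' - h)\<close>. The product is -1, shown here with denominators
    cleared.\<close>
  have "((g' * a + g * a') * (b + b')) * ((g - g') * (h' - h)) =
      ((g - g') * (g' * a) - (g' - g) * (g * a')) * ((h' - h) * b - (h - h') * b')"
    by (simp add: algebra_simps)
  also have "\<dots> = (h' - h) * (g' - g)"
    unfolding 1 2 by simp
  also have "\<dots> = (- 1) * ((g - g') * (h' - h))" by (simp add: algebra_simps)
  finally have cross: "(g' * a + g * a') * (b + b') = - 1"
    by (subst (asm) mult_right_cancel) (use ne in auto)
  have "pair_factor m n t = (g + a * (b + b')) * (g' + a' * (b + b')) - a * a' * (b - b')\<^sup>2"
    unfolding pair_factor_def Let_def ab h2 unfolding gh ..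
  \<comment> \<open>The squares combine by \<open>(b + b')^2 - (b - b')^2 = 4 b b'\<close>; then
    \<open>g g' = 1\<close> cancels against the cross term -1.\<close>
  also have "\<dots> = g * g' + (g' * a + g * a') * (b + b') + 4 * (a * a' * (b * b'))"
    by (simp add: algebra_simps power2_eq_square)
  also have "\<dots> = 4 * (a * a' * (b * b'))" using cross inv by simp
  finally have P: "cmod (pair_factor m n t) = 4 * (cmod a * cmod a' * (cmod b * cmod b'))"
    by (simp add: norm_mult)
  have n1: "cmod h = 1" "cmod g = 1" "cmod (h\<^sup>2) = 1" using nt by (simp_all add: gh norm_power)
  have hi: "h' = inverse h" "g' = inverse g" "h'\<^sup>2 = inverse (h\<^sup>2)" by (simp_all add: gh power_inverse)
  have "cmod (1 - t) * cmod a = cmod (1 - h)" "cmod (1 - t) * cmod a' = cmod (1 - h)"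
    using A[THEN arg_cong[of _ _ cmod]] cmod_one_minus_inverse[OF nt] cmod_one_minus_inverse[OF n1(1)]
    unfolding hi norm_mult by simp_all
  then have na: "cmod a = cmod (1 - h) / cmod (1 - t)" "cmod a' = cmod (1 - h) / cmod (1 - t)"
    using assms(2) by (simp_all add: field_simps)
  have "cmod (1 - h\<^sup>2) * cmod b = cmod (1 - g)" "cmod (1 - h\<^sup>2) * cmod b' = cmod (1 - g)"
    using B[THEN arg_cong[of _ _ cmod]] cmod_one_minus_inverse[OF n1(2)] cmod_one_minus_inverse[OF n1(3)] n1(1)
    unfolding hi(3) unfolding hi(1,2) norm_mult norm_inverse by simp_all
  then have nb: "cmod b = cmod (1 - g) / cmod (1 - h\<^sup>2)" "cmod b' = cmod (1 - g) / cmod (1 - h\<^sup>2)"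
    using \<open>h\<^sup>2 \<noteq> 1\<close> by (simp_all add: field_simps)
  show "cmod (pair_factor m n t) =
      4 * (cmod (1 - t ^ m) * cmod (1 - t ^ (2 * m * n)) / (cmod (1 - t) * cmod (1 - t ^ (2 * m))))\<^sup>2"
    unfolding P na nb gh(1,3)[symmetric] h2(1)[symmetric]
    by (simp add: power2_eq_square times_divide_times_eq mult_ac)
qed

section \<open>The torsion as a product over invariant planes\<close>

lemma torsion_rho:
  fixes \<xi> :: complex and m n i N :: nat
  defines "z \<equiv> \<xi> ^ i"
  assumes rho: "is_rho m n \<xi> i \<rho>" and zQ: "z ^ (4 * m * n + 1) = 1"
  shows "torsion_num m n (2 * N) (sigma (2 * N) \<circ> \<rho>) = (\<Prod>k<N. pair_factor m n (z ^ (2 * k + 1)))"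
    and "torsion_den m n (2 * N) (sigma (2 * N) \<circ> \<rho>) = 2 ^ N"
proof -
  define d where "d = 2 * N"
  define f where "f = (\<lambda>g. \<rho> (knot_gen m n g))"
  define R where "R = (\<lambda>w. sigma d (word_eval (SL 2) f w))"
  \<comment> \<open>\<open>t\<close> and \<open>s\<close> are the entries given by
    \<open>sigma_diag2\<close> at \<open>z\<close> and \<open>sigma_anti2\<close> at 1.\<close>
  define t where "t = (\<lambda>j. inverse z ^ (d - 1 - j) * z ^ j)"
  define s :: "nat \<Rightarrow> complex" where "s = (\<lambda>j. (- 1) ^ (d - 1 - j))"
  have hom: "\<rho> \<in> hom (knot_group m n) (SL 2)" using rho by (simp add: is_rho_def)
  have z0: "z \<noteq> 0" using zQ by auto
  have "\<xi> ^ (2 * m * i) = z ^ (2 * m)"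
    by (simp add: z_def mult.commute flip: power_mult)
  then have fg: "f X1 = diag2 z" "f X2 = diag2 (z ^ (2 * m))" "f Mu = anti2 1"
    using rho by (simp_all only: is_rho_def f_def diag2_def anti2_def z_def power_int_minus
        power_int_of_nat inverse_1)
  have mono: "\<exists>a. a \<noteq> 0 \<and> (f g = diag2 a \<or> f g = anti2 a)" for g
    using z0 by (cases g) (auto simp: fg intro: exI[of _ z] exI[of _ "z ^ (2 * m)"] exI[of _ 1])
  then have fc: "f g \<in> carrier (SL 2)" for g
    using diag_anti_carrier by metis
  have R_carrier: "R w \<in> carrier_mat d d" for w
    by (simp add: R_def sigma_def)
  have R_append: "R (u @ v) = R u * R v" for u v
  proof -
    obtain a b where "a \<noteq> 0" "word_eval (SL 2) f u = diag2 a \<or> word_eval (SL 2) f u = anti2 a"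
      "b \<noteq> 0" "word_eval (SL 2) f v = diag2 b \<or> word_eval (SL 2) f v = anti2 b"
      using monomial_word[of f, OF mono] by meson
    then show ?thesis
      unfolding R_def word_eval_append[OF group_SL fc] SL_simps by (intro sigma_mult_monomial)
  qed
  have R_Nil: "R [] = 1\<^sub>m d"
  proof -
    have "R [] = sigma d (diag2 1)" by (simp add: R_def SL_simps diag2_one)
    then show ?thesis by (simp add: sigma_diag2 one_pair_mat)
  qed
  have R_letter: "R [Pos g] = sigma d (f g)" "R [Neg g] = sigma d (inv\<^bsub>SL 2\<^esub> f g)" for g
    using fc[of g] group.inv_closed[OF group_SL fc[of g]] group.is_monoid[OF group_SL]
    by (simp_all add: R_def monoid.r_one)
  have X1: "R [Pos X1] = pair_mat d t (\<lambda>_. 0)" "R [Neg X1] = pair_mat d (\<lambda>j. inverse (t j)) (\<lambda>_. 0)"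
    using z0 by (auto simp: R_letter fg diag_anti_inv sigma_diag2 t_def power_inverse
        intro!: pair_mat_cong)
  have X2: "R [Pos X2] = pair_mat d (\<lambda>j. t j ^ (2 * m)) (\<lambda>_. 0)"
    "R [Neg X2] = pair_mat d (\<lambda>j. inverse (t j ^ (2 * m))) (\<lambda>_. 0)"
    using z0 by (auto simp: R_letter fg diag_anti_inv sigma_diag2 t_def power_inverse power_mult_distrib
        mult_ac simp flip: power_mult intro!: pair_mat_cong)
  \<comment> \<open>Evenness of the dimension enters here: the sign is
    \<open>(-1)^(d - 1)\<close>.\<close>
  have s: "s (d - 1 - j) * s j = -1" if "j < d" for j
  proof -
    have "s (d - 1 - j) * s j = (- 1) ^ (d - 1)"
      using that by (simp add: s_def flip: power_add)
    also have "odd (d - 1)" using that by (simp add: d_def)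
    then have "(- 1) ^ (d - 1) = (- 1 :: complex)" by (rule power_minus_odd[of _ 1, simplified])
    finally show ?thesis .
  qed
  have "(- 1) ^ j = - s j" if "j < d" for j
  proof -
    have "s (d - 1 - j) = (- 1) ^ j" using that by (simp add: s_def)
    moreover have "s j * s j = 1" by (simp add: s_def flip: power_mult_distrib)
    ultimately show ?thesis using s[OF that] by (metis mult.assoc mult.right_neutral mult_minus1)
  qed
  then have Mu: "R [Pos Mu] = pair_mat d (\<lambda>_. 0) s" "R [Neg Mu] = pair_mat d (\<lambda>_. 0) (\<lambda>j. - s j)"
    by (auto simp: R_letter fg diag_anti_inv sigma_anti2 s_def intro!: pair_mat_cong)
  have t_inv: "t (d - 1 - j) = inverse (t j)" if "j < d" for j
    using that by (simp add: t_def power_inverse mult.commute)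
  have tQ: "t j ^ (4 * m * n + 1) = 1" for j
  proof -
    have "t j ^ (4 * m * n + 1) =
        inverse (z ^ (4 * m * n + 1)) ^ (d - 1 - j) * (z ^ (4 * m * n + 1)) ^ j"
      unfolding t_def power_mult_distrib power_inverse[symmetric] power_mult[symmetric]
      by (simp only: mult.commute)
    then show ?thesis by (simp only: zQ inverse_1 power_one mult_1)
  qed
  have \<rho>_word: "(sigma d \<circ> \<rho>) (knot_proj m n (word_class w)) = R w" for w
    by (simp add: hom_knot_group_word_eval[OF hom group_SL] R_def f_def)
  note F = fox_relators[where \<phi> = "\<lambda>a. (sigma d \<circ> \<rho>) (knot_proj m n a)",
      OF \<rho>_word R_carrier R_append R_Nil X1 X2 Mu t_inv tQ s,
      simplified implies_True_equals True_implies_equals triv_forall_equality]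
  define S where "S = (\<lambda>j. \<Sum>i<m. t j ^ i)"
  define c where "c = (\<lambda>j. \<Sum>i<n. (t j ^ (2 * m)) ^ i)"
  define h where "h = (\<lambda>j. t j ^ m)"
  have t0: "t j \<noteq> 0" for j using z0 by (simp add: t_def)
  define A where "A = pair_mat d (\<lambda>j. - S j) (\<lambda>j. s j * S j)"
  define B where "B = pair_mat d (\<lambda>j. inverse (h j)) (\<lambda>_. 0)"
  define C where "C = pair_mat d (\<lambda>_. 0) (\<lambda>j. s j * t j ^ (2 * m * n))"
  define D where "D = pair_mat d (\<lambda>j. - c j) (\<lambda>j. s j * c j)"
  \<comment> \<open>This is \<open>- A\<close> multiplied from the left by the inverse of
    \<open>B\<close>; the antidiagonal entry of column \<open>j\<close> lies in row
    \<open>d - 1 - j\<close>, where that inverse has the entry \<open>1 / h j\<close>.\<close>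
  define G where "G = pair_mat d (\<lambda>j. h j * S j) (\<lambda>j. - (s j * S j * inverse (h j)))"
  have h0: "h j \<noteq> 0" for j using t0 by (simp add: h_def)
  have h_inv: "h (d - 1 - j) = inverse (h j)" if "j < d" for j
    using t_inv[OF that] by (simp add: h_def power_inverse)
  have BG: "B * G = - A"
    unfolding A_def B_def G_def pair_mat_mult pair_mat_uminus
    by (rule pair_mat_cong) (use h0 h_inv in \<open>simp_all add: field_simps\<close>)
  have "det B = (\<Prod>k<N. inverse (h k) * inverse (h (2 * N - 1 - k)))"
    unfolding B_def d_def det_pair_mat by simp
  also have "\<dots> = (\<Prod>k<N. 1)"
    by (rule prod.cong) (use h0 h_inv in \<open>auto simp: d_def\<close>)
  finally have detB: "det B = 1" by simp
  define b where "b = (\<lambda>j. h j * c j)"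
  \<comment> \<open>This is \<open>b\<close> at the partner index \<open>d - 1 - j\<close>.\<close>
  define b' where "b' = (\<lambda>j. inverse (h j) * c (d - 1 - j))"
  have CDG: "C + D * G = pair_mat d (\<lambda>j. - (S j * (b j - b' j)))
      (\<lambda>j. s j * (t j ^ (2 * m * n) + S j * (b j + b' j)))"
    unfolding C_def D_def G_def pair_mat_mult pair_mat_add
  proof (rule pair_mat_cong)
    fix j assume j: "j < d"
    have "s (d - 1 - j) * c (d - 1 - j) * - (s j * S j * inverse (h j)) =
        - (s (d - 1 - j) * s j) * (c (d - 1 - j) * S j * inverse (h j))" by simp
    also have "\<dots> = S j * b' j" unfolding s[OF j] b'_def by simp
    finally show "0 + (- c j * (h j * S j) + s (d - 1 - j) * c (d - 1 - j) * - (s j * S j * inverse (h j))) =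
        - (S j * (b j - b' j))"
      by (simp add: b_def algebra_simps)
  qed (simp add: b_def b'_def algebra_simps)
  have "torsion_num m n d (sigma d \<circ> \<rho>) = det (four_block_mat A B C D)"
    unfolding torsion_num_def fox_matrix_def Let_def F A_def B_def C_def D_def S_def c_def h_def ..
  also have "\<dots> = det B * det (C + D * G)"
    using BG by (intro det_four_block_mat_schur[where d = d])
      (simp_all add: A_def B_def C_def D_def G_def d_def)
  also have "\<dots> = (\<Prod>k<N. pair_factor m n (t k))"
    unfolding detB CDG unfolding d_def det_pair_mat
  proof (simp only: mult_1, rule prod.cong[OF refl])
    fix k assume "k \<in> {..<N}"
    then have k: "k < d" "d - 1 - (d - 1 - k) = k" "d - 1 - k < d" by (auto simp: d_def)
    let ?k = "2 * N - 1 - k"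
    have k': "?k = d - 1 - k" by (simp add: d_def)
    have 1: "t ?k = inverse (t k)" "h ?k = inverse (h k)" "b ?k = b' k" "b' ?k = b k"
      unfolding k' b_def b'_def k(2) using t_inv[OF k(1)] h_inv[OF k(1)] by simp_all
    have ss: "s k * s ?k = -1" unfolding k' using s[OF k(1)] by (simp only: mult.commute)
    have alg: "- (x * (u - v)) * - (y * (v - u)) - s k * p * (s ?k * r) = p * r - x * y * (u - v)\<^sup>2"
      for x y u v p r
    proof -
      have "s k * p * (s ?k * r) = (s k * s ?k) * (p * r)" by (simp only: mult_ac)
      then show ?thesis unfolding ss by (simp add: algebra_simps power2_eq_square)
    qed
    have "- (S k * (b k - b' k)) * - (S ?k * (b ?k - b' ?k)) -
      s k * (t k ^ (2 * m * n) + S k * (b k + b' k)) * (s ?k * (t ?k ^ (2 * m * n) + S ?k * (b ?k + b' ?k))) =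
      (t k ^ (2 * m * n) + S k * (b k + b' k)) * (t ?k ^ (2 * m * n) + S ?k * (b k + b' k)) -
      S k * S ?k * (b k - b' k)\<^sup>2"
      unfolding 1(3,4) alg by (simp only: add.commute[of "b' k"])
    also have "\<dots> = pair_factor m n (t k)"
      unfolding pair_factor_def Let_def S_def b_def b'_def c_def h_def k'[symmetric] 1(1) power_inverse ..
    finally show "- (S k * (b k - b' k)) * - (S ?k * (b ?k - b' ?k)) -
      s k * (t k ^ (2 * m * n) + S k * (b k + b' k)) * (s ?k * (t ?k ^ (2 * m * n) + S ?k * (b ?k + b' ?k))) =
      pair_factor m n (t k)" .
  qed
  \<comment> \<open>The first half of the basis has the exponents \<open>-(2N - 1), ..., -1\<close>.
    Inverting and reversing them gives \<open>1, 3, ..., 2N - 1\<close>, so that the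
    \<open>k\<close>-th factor no longer depends on \<open>N\<close>.\<close>
  also have "\<dots> = (\<Prod>k<N. pair_factor m n (z ^ (2 * (N - Suc k) + 1)))"
  proof (rule prod.cong[OF refl])
    fix k assume "k \<in> {..<N}"
    then have e: "d - 1 - k = (2 * (N - Suc k) + 1) + k" by (auto simp: d_def)
    have "inverse (z ^ k) * z ^ k = 1" using z0 by simp
    then have "t k = inverse (z ^ (2 * (N - Suc k) + 1))"
      unfolding t_def e power_add[of _ _ k] power_inverse inverse_mult_distrib mult.assoc by (simp only: mult_1_right)
    then show "pair_factor m n (t k) = pair_factor m n (z ^ (2 * (N - Suc k) + 1))"
      by (simp only: pair_factor_inverse)
  qed
  also have "\<dots> = (\<Prod>k<N. pair_factor m n (z ^ (2 * k + 1)))"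
    by (rule prod.nat_diff_reindex)
  finally show "torsion_num m n (2 * N) (sigma (2 * N) \<circ> \<rho>) = (\<Prod>k<N. pair_factor m n (z ^ (2 * k + 1)))"
    by (simp only: d_def)

  interpret \<rho>: group_hom "knot_group m n" "SL 2" \<rho>
    by (intro group_hom.intro group_knot_group group_SL group_hom_axioms.intro hom)
  have "(sigma d \<circ> \<rho>) (knot_gen m n Mu) = pair_mat d (\<lambda>_. 0) s"
    using Mu(1) by (simp add: R_letter f_def)
  moreover have "(sigma d \<circ> \<rho>) \<one>\<^bsub>knot_group m n\<^esub> = 1\<^sub>m d"
    using R_Nil \<rho>.hom_one by (simp add: R_def)
  ultimately have "torsion_den m n d (sigma d \<circ> \<rho>) = det (pair_mat d (\<lambda>_. - 1) s)"
    unfolding torsion_den_def lin_ext_diff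
    by (simp add: lin_ext_single one_pair_mat pair_mat_minus)
  \<comment> \<open>On each plane the determinant is
    \<open>(-1) * (-1) - s k * s (2N - 1 - k) = 2\<close>.\<close>
  also have "\<dots> = (\<Prod>k<N. 2)"
    unfolding d_def det_pair_mat
    by (rule prod.cong) (use s in \<open>auto simp: d_def mult.commute\<close>)
  finally show "torsion_den m n (2 * N) (sigma (2 * N) \<circ> \<rho>) = 2 ^ N"
    by (simp add: d_def)
qed

section \<open>Averages over a period\<close>

text \<open>As \<open>c\<close> is invertible modulo \<open>q\<close>, the affine map permutes the
  residues.\<close>

lemma sum_periodic_affine:
  fixes f :: "nat \<Rightarrow> real"
  assumes f: "\<And>j. f (j mod q) = f j" and "coprime c q"
  shows "(\<Sum>k<q. f (c * k + b)) = (\<Sum>k<q. f k)"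
proof (cases "q = 0")
  case False
  let ?h = "\<lambda>k. (c * k + b) mod q"
  have "inj_on ?h {..<q}"
  proof (rule inj_onI)
    fix x y assume xy: "x \<in> {..<q}" "y \<in> {..<q}" "?h x = ?h y"
    then have "[c * x + b = c * y + b] (mod q)" by (simp add: cong_def)
    then have "[x = y] (mod q)"
      using assms(2) by (simp add: cong_add_rcancel_nat cong_mult_lcancel_nat)
    with xy show "x = y" by (simp add: cong_def)
  qed
  moreover from this have "?h ` {..<q} = {..<q}"
    using False by (intro endo_inj_surj) auto
  ultimately have "(\<Sum>k<q. f (?h k)) = (\<Sum>k<q. f k)"
    by (intro sum.reindex_bij_betw) (simp add: bij_betw_def)
  then show ?thesis by (simp add: f)
qed simp

text \<open>The partial sums minus their linear growth form a periodic, hence bounded, sequence,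
  which vanishes in the limit after division by \<open>N\<close>.\<close>

lemma periodic_average_tendsto:
  fixes p :: "nat \<Rightarrow> real"
  assumes p: "\<And>k. p (k + q) = p k" and "q > 0"
  shows "(\<lambda>N. (\<Sum>k<N. p k) / real N) \<longlonglongrightarrow> (\<Sum>k<q. p k) / real q"
proof -
  define S where "S = (\<Sum>k<q. p k)"
  define e where "e = (\<lambda>N. (\<Sum>k<N. p k) - real N * S / real q)"
  have e: "e (N + q) = e N" for N
  proof -
    have "(\<Sum>k<N + q. p k) = S + (\<Sum>k<N. p k)"
      by (induction N) (simp_all add: S_def p)
    then show ?thesis using \<open>q > 0\<close> by (simp add: e_def field_simps)
  qed
  have e_mod: "e N = e (N mod q)" for N
  proof (induction N rule: less_induct)
    case (less N)
    show ?case
    proof (cases "N < q")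
      case False
      with less.IH[of "N - q"] e[of "N - q"] \<open>q > 0\<close> show ?thesis
        by (simp add: le_mod_geq)
    qed simp
  qed
  define B where "B = Max ((\<lambda>k. \<bar>e k\<bar>) ` {..<q})"
  have B: "\<bar>e N\<bar> \<le> B" for N
    unfolding B_def e_mod[of N] using \<open>q > 0\<close> by (intro Max_ge) auto
  have "(\<lambda>N. e N / real N) \<longlonglongrightarrow> 0"
    by (rule tendsto_0_le[OF lim_1_over_n[where 'a = real], where K = B])
       (auto intro!: always_eventually divide_right_mono B)
  then have "(\<lambda>N. e N / real N + S / real q) \<longlonglongrightarrow> 0 + S / real q"
    by (intro tendsto_add tendsto_const)
  \<comment> \<open>At \<open>N = 0\<close> division by zero breaks the identity, so it is claimed
    only eventually.\<close>
  moreover have "\<forall>\<^sub>F N in sequentially. e N / real N + S / real q = (\<Sum>k<N. p k) / real N"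
    using eventually_gt_at_top[of 0]
    by eventually_elim (simp add: e_def field_simps)
  ultimately show ?thesis
    unfolding S_def by (simp add: tendsto_cong)
qed

text \<open>One formula for all \<open>t\<close> allows summation over a full period. At
  \<open>t = 1\<close> the four logarithms are the same term \<open>ln 0\<close> and cancel, and
  \<open>2 ln (2mn + 1)\<close> is split as \<open>2 ln 2 + 2 ln ((2mn + 1)/2)\<close>.\<close>

lemma ln_cmod_pair_factor:
  assumes "t ^ (4 * m * n + 1) = 1"
  shows "pair_factor m n t \<noteq> 0"
    and "ln (cmod (pair_factor m n t)) =
      2 * ln 2 + (if t = 1 then 2 * ln (real (2 * m * n + 1) / 2) else 0) +
      2 * (ln (cmod (1 - t ^ m)) + ln (cmod (1 - t ^ (2 * m * n))) - ln (cmod (1 - t)) - ln (cmod (1 - t ^ (2 * m))))"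
proof -
  have "pair_factor m n t \<noteq> 0 \<and> ln (cmod (pair_factor m n t)) =
      2 * ln 2 + (if t = 1 then 2 * ln (real (2 * m * n + 1) / 2) else 0) +
      2 * (ln (cmod (1 - t ^ m)) + ln (cmod (1 - t ^ (2 * m * n))) - ln (cmod (1 - t)) - ln (cmod (1 - t ^ (2 * m))))"
  proof (cases "t = 1")
    case True
    have "cmod (pair_factor m n t) = (real (2 * m * n + 1))\<^sup>2"
      unfolding True pair_factor_one norm_of_nat by simp
    moreover have "real (2 * m * n + 1) > 0" unfolding of_nat_0_less_iff by simp
    ultimately show ?thesis
      by (auto simp: True ln_realpow ln_div simp del: of_nat_Suc of_nat_add of_nat_mult)
  next
    case False
    note ne = cmod_pair_factor(1-3)[OF assms False]
    have "ln (4 * (x * y / (u * v))\<^sup>2) = 2 * ln 2 + 2 * (ln x + ln y - ln u - ln v)"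
      if "x > 0" "y > 0" "u > 0" "v > 0" for x y u v :: real
    proof -
      have "4 * (x * y / (u * v))\<^sup>2 = (2 * (x * y / (u * v)))\<^sup>2" by (simp add: power2_eq_square)
      then show ?thesis using that by (simp add: ln_realpow ln_mult ln_div)
    qed
    then show ?thesis
      unfolding cmod_pair_factor(4)[OF assms False]
      using ne False cmod_pair_factor(4)[OF assms False] by auto
  qed
  then show "pair_factor m n t \<noteq> 0"
    and "ln (cmod (pair_factor m n t)) =
      2 * ln 2 + (if t = 1 then 2 * ln (real (2 * m * n + 1) / 2) else 0) +
      2 * (ln (cmod (1 - t ^ m)) + ln (cmod (1 - t ^ (2 * m * n))) - ln (cmod (1 - t)) - ln (cmod (1 - t ^ (2 * m))))"
    by blast+
qed

lemma sum_ln_pair_factor_period: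
  assumes z: "\<And>j. z ^ j = 1 \<longleftrightarrow> q dvd j" and q: "q > 0" "q dvd 4 * m * n + 1"
  shows "(\<Sum>k<q. ln (cmod (pair_factor m n (z ^ (2 * k + 1)))) - ln 2) =
    real q * ln 2 + 2 * ln (real (2 * m * n + 1) / 2)"
proof -
  have zq: "z ^ q = 1" using z by simp
  have z_mod: "z ^ (j mod q) = z ^ j" for j
  proof -
    have "z ^ j = z ^ (q * (j div q) + j mod q)" by simp
    then show ?thesis by (simp only: power_add power_mult zq power_one mult_1)
  qed
  \<comment> \<open>The exponent is \<open>2 e k + e\<close>, and \<open>2 e\<close> divides
    \<open>4mn\<close>, which is prime to \<open>4mn + 1\<close> and so to \<open>q\<close>. This
    covers \<open>e = 1, m, 2m, 2mn\<close>.\<close>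
  have shift: "(\<Sum>k<q. F ((z ^ (2 * k + 1)) ^ e)) = (\<Sum>j<q. F (z ^ j))" if "e dvd 2 * m * n"
    for F :: "complex \<Rightarrow> real" and e
  proof -
    have "2 * e dvd 2 * (2 * m * n)" using that by (rule mult_dvd_mono[OF dvd_refl])
    also have "2 * (2 * m * n) = 4 * m * n" by simp
    finally have "2 * e dvd 4 * m * n" .
    moreover have "coprime (4 * m * n) (4 * m * n + 1)"
      unfolding Suc_eq_plus1[symmetric] by (rule coprime_Suc_right_nat)
    ultimately have "coprime (2 * e) q" using q(2) coprime_divisors by blast
    then have "(\<Sum>k<q. F (z ^ (2 * e * k + e))) = (\<Sum>j<q. F (z ^ j))"
      by (intro sum_periodic_affine) (simp_all add: z_mod)
    moreover have "(z ^ (2 * k + 1)) ^ e = z ^ (2 * e * k + e)" for k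
      by (simp add: algebra_simps flip: power_mult power_add)
    ultimately show ?thesis by simp
  qed
  let ?c = "2 * ln (real (2 * m * n + 1) / 2)"
  define L where "L = (\<lambda>e. \<Sum>k<q. ln (cmod (1 - (z ^ (2 * k + 1)) ^ e)))"
  have L: "L e = (\<Sum>j<q. ln (cmod (1 - z ^ j)))" if "e dvd 2 * m * n" for e
    unfolding L_def by (rule shift[OF that])
  have "(z ^ (2 * k + 1)) ^ (4 * m * n + 1) = 1" for k
    using q(2) by (simp only: z dvd_mult flip: power_mult)
  note P = ln_cmod_pair_factor(2)[OF this]
  have "(\<Sum>k<q. ln (cmod (pair_factor m n (z ^ (2 * k + 1)))) - ln 2) =
      (\<Sum>k<q. ln 2 + (if z ^ (2 * k + 1) = 1 then ?c else 0) +
        2 * (ln (cmod (1 - (z ^ (2 * k + 1)) ^ m)) + ln (cmod (1 - (z ^ (2 * k + 1)) ^ (2 * m * n))) -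
             ln (cmod (1 - (z ^ (2 * k + 1)) ^ 1)) - ln (cmod (1 - (z ^ (2 * k + 1)) ^ (2 * m)))))"
    unfolding P power_one_right by (intro sum.cong refl) linarith
  also have "\<dots> = real q * ln 2 + (\<Sum>k<q. if z ^ (2 * k + 1) = 1 then ?c else 0) +
      2 * (L m + L (2 * m * n) - L 1 - L (2 * m))"
    unfolding L_def sum.distrib sum_subtractf sum_distrib_left[symmetric] by simp
  \<comment> \<open>All four equal the same sum over a period, including its term
    \<open>ln 0\<close> at \<open>j = 0\<close>.\<close>
  also have "L m + L (2 * m * n) - L 1 - L (2 * m) = 0"
    by (simp add: L)
  \<comment> \<open>By the shift with \<open>e = 1\<close>, the value 1 is hit exactly once in a
    period.\<close>
  also have "(\<Sum>k<q. if z ^ (2 * k + 1) = 1 then ?c else 0) = (\<Sum>j<q. if z ^ j = 1 then ?c else 0)"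
    using shift[of 1 "\<lambda>x. if x = 1 then ?c else 0"] by (simp only: power_one_right one_dvd)
  also have "\<dots> = (\<Sum>j<q. if j = 0 then ?c else 0)"
    by (intro sum.cong refl) (auto simp: z dest: dvd_imp_le)
  also have "\<dots> = ?c" using q(1) by simp
  finally show ?thesis by simp
qed

section \<open>The growth rate of the torsion\<close>

theorem corollary4p7:
  fixes m n i q :: nat and \<xi> :: complex and \<rho> :: "gen word set set \<Rightarrow> complex mat"
  assumes "m > 0" and "n > 0"
    and "\<xi> = exp (2 * of_real pi * \<i> / of_nat (4 * m * n + 1))"
    and "1 \<le> i" and "i \<le> 2 * m * n"
    and "is_rho m n \<xi> i \<rho>"
    and "irreducible_rep (knot_group m n) 2 \<rho>"
    and "metabelian_rep (knot_group m n) \<rho>"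
    and "q = (4 * m * n + 1) div gcd (4 * m * n + 1) i"
  shows "(\<forall>N\<ge>1. torsion_defined m n (2 * N) (sigma (2 * N) \<circ> \<rho>)) \<and>
    (\<lambda>N. ln (cmod (torsion m n (2 * N) (sigma (2 * N) \<circ> \<rho>))) / real (2 * N))
      \<longlonglongrightarrow> 1 / real q * ln (real (2 * m * n + 1) / 2) + 1 / 2 * ln 2 \<and>
    1 / real q * ln (real (2 * m * n + 1) / 2) + 1 / 2 * ln 2
      = real (gcd (4 * m * n + 1) i) / real (4 * m * n + 1) * ln (real (2 * m * n + 1) / 2)
        + 1 / 2 * ln 2 \<and>
    convergent (\<lambda>N. ln (cmod (torsion m n (2 * N) (sigma (2 * N) \<circ> \<rho>))) / real (2 * N))"
proof -
  define Q where "Q = 4 * m * n + 1"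
  define z where "z = \<xi> ^ i"
  define T where "T = (\<lambda>N. torsion m n (2 * N) (sigma (2 * N) \<circ> \<rho>))"
  define p where "p = (\<lambda>k. ln (cmod (pair_factor m n (z ^ (2 * k + 1)))) - ln 2)"
  let ?l = "1 / real q * ln (real (2 * m * n + 1) / 2) + 1 / 2 * ln 2"
  have q: "q = Q div gcd Q i" using assms(9) by (simp add: Q_def)
  have gQ: "gcd Q i > 0" "q * gcd Q i = Q" "q > 0"
    unfolding q by (simp_all add: Q_def div_greater_zero_iff gcd_le1_nat)
  then have q_dvd: "q dvd 4 * m * n + 1" unfolding Q_def[symmetric] by (metis dvd_triv_left)
  \<comment> \<open>\<xi> has order exactly \<open>Q\<close>, as its first \<open>Q\<close> powers
    are distinct roots of unity.\<close>
  have \<xi>: "\<xi> ^ j = 1 \<longleftrightarrow> Q dvd j" for j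
  proof -
    have "inj_on (\<lambda>k. cis (2 * pi * real k / real Q)) {..<Q}"
      using bij_betw_roots_unity[of Q] by (simp add: Q_def bij_betw_def)
    moreover have cis: "\<xi> ^ k = cis (2 * pi * real k / real Q)" for k
      unfolding assms(3) Q_def[symmetric] exp_of_nat_mult[symmetric] cis_conv_exp by (simp add: mult_ac)
    ultimately have "\<xi> ^ (j mod Q) = \<xi> ^ 0 \<longleftrightarrow> j mod Q = 0"
      unfolding cis by (intro inj_on_eq_iff) (auto simp: Q_def)
    moreover have "\<xi> ^ Q = 1" unfolding cis by (simp add: Q_def)
    then have "\<xi> ^ (j mod Q) = \<xi> ^ j"
      by (metis mult_1 mult_div_mod_eq power_add power_mult power_one)
    ultimately show ?thesis by (simp add: mod_eq_0_iff_dvd)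
  qed
  have z: "z ^ j = 1 \<longleftrightarrow> q dvd j" for j
  proof -
    have "z ^ j = 1 \<longleftrightarrow> Q dvd i * j" by (simp add: z_def \<xi> flip: power_mult)
    \<comment> \<open>Taking the gcd out of both sides leaves \<open>q\<close> and a cofactor of
      \<open>i\<close> prime to it.\<close>
    also have "\<dots> \<longleftrightarrow> q * gcd Q i dvd (i div gcd Q i) * j * gcd Q i"
      unfolding gQ(2) by (simp add: mult.commute mult.left_commute flip: mult.assoc)
    also have "\<dots> \<longleftrightarrow> q dvd (i div gcd Q i) * j"
      using gQ(1) by simp
    also have "\<dots> \<longleftrightarrow> q dvd j"
      unfolding q using gQ(1) by (intro coprime_dvd_mult_right_iff div_gcd_coprime) (simp add: Q_def)
    finally show ?thesis .
  qed
  have zQ: "z ^ (4 * m * n + 1) = 1" using q_dvd by (simp only: z)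
  have "(z ^ (2 * k + 1)) ^ (4 * m * n + 1) = 1" for k
    using q_dvd by (simp only: z dvd_mult flip: power_mult)
  note nz = ln_cmod_pair_factor(1)[OF this]
  note num = torsion_rho(1)[OF assms(6) zQ[unfolded z_def], folded z_def]
    and den = torsion_rho(2)[OF assms(6) zQ[unfolded z_def]]
  have defined: "torsion_defined m n (2 * N) (sigma (2 * N) \<circ> \<rho>)" for N
    using nz by (simp add: torsion_defined_def num den)
  have ln_T: "ln (cmod (T N)) = (\<Sum>k<N. p k)" for N
  proof -
    have "cmod (T N) = (\<Prod>k<N. cmod (pair_factor m n (z ^ (2 * k + 1))) / 2)"
      by (simp add: T_def torsion_def num den norm_divide norm_power prod_norm prod_dividef)
    also have "ln \<dots> = (\<Sum>k<N. ln (cmod (pair_factor m n (z ^ (2 * k + 1))) / 2))"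
      using nz by (intro ln_prod) auto
    also have "\<dots> = (\<Sum>k<N. p k)"
      unfolding p_def using nz by (intro sum.cong refl) (simp add: ln_div)
    finally show ?thesis .
  qed
  have "p (k + q) = p k" for k
  proof -
    have "z ^ (2 * (k + q) + 1) = z ^ (2 * k + 1) * (z ^ q) ^ 2"
      by (simp add: algebra_simps flip: power_mult power_add)
    also have "z ^ q = 1" by (simp add: z)
    finally have "z ^ (2 * (k + q) + 1) = z ^ (2 * k + 1)" by (simp only: power_one mult_1_right)
    then show ?thesis by (simp only: p_def)
  qed
  then have "(\<lambda>N. (\<Sum>k<N. p k) / real N / 2) \<longlonglongrightarrow> (\<Sum>k<q. p k) / real q / 2"
    by (intro tendsto_divide tendsto_const periodic_average_tendsto gQ) simp_all
  \<comment> \<open>The period sum is \<open>q ln 2 + 2 ln ((2mn + 1)/2)\<close>; the extra 2 in the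
    denominator comes from the dimension \<open>2N\<close>.\<close>
  also have "(\<Sum>k<q. p k) / real q / 2 = ?l"
    unfolding p_def sum_ln_pair_factor_period[OF z gQ(3) q_dvd] using gQ(3)
    by (simp add: field_simps)
  finally have lim: "(\<lambda>N. ln (cmod (T N)) / real (2 * N)) \<longlonglongrightarrow> ?l"
    by (simp add: ln_T mult.commute)
  have "real q * real (gcd Q i) = real Q" unfolding of_nat_mult[symmetric] gQ(2) ..
  then have "1 / real q = real (gcd Q i) / real Q"
    using gQ(1,3) by (metis divide_self_if mult.commute mult_divide_mult_cancel_left mult.right_neutral of_nat_0_less_iff order_less_irrefl)
  then show ?thesis
    using defined lim convergentI[OF lim] by (simp only: T_def Q_def) blast
qed

end
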